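(* Let $X$ be an irreducible reduced surface of degree $d\geq 3$ in $\mathbb{P}^3$ over $\mathbb{C}$, and let $\Lambda\not\subset\mathrm{Sing}(X)$ be a line on $X$ containing $d-1$ (distinct) singularities of $X$ of type $A_{d-1}$. Let $P$ be a smooth star point of $X$ on $\Lambda$. Then there is a $1$-parameter family $(X(t),\Lambda(t),P(t))$ with $(X(0),\Lambda(0),P(0))=(X,\Lambda,P)$ such that for $t\neq 0$, $X(t)$ is a surface of degree $d$ in $\mathbb{P}^3$, the line $\Lambda(t)$ contains $d-1$ (distinct) $A_{d-2}$-singularities of $X(t)$, and $P(t)$ is a smooth star point of $X(t)$ on $\Lambda(t)$.
   Context: The ground field is $\mathbb{C}$, and $\mathrm{Sing}(X)$ is the singular locus of $X$. A point $P$ of an irreducible surface $X\subset\mathbb{P}^3$ of degree $d\geq 3$ is called a star point on $X$ if there is a plane $\Pi\subset\mathbb{P}^3$ such that the scheme $\Pi\cap X$ is a cone with vertex $P$; that is, in homogeneous coordinates $(Y_0:Y_1:Y_2)$ on $\Pi$ with $P=(1:0:0)$, the scheme $\Pi\cap X$ is defined by a form of degree $d$ not involving $Y_0$. A smooth star point is a star point that is a smooth point of $X$ (then $\Pi=T_P(X)$ is the embedded tangent plane). A point $P$ of a surface $X\subset\mathbb{P}^3$ is an $A_k$-singularity ($k\geq 1$) if in suitable local analytic coordinates $(z_1,z_2,z_3)$ of $\mathbb{P}^3$ centered at $P$ the surface $X$ has equation $z_1^2+z_2^2+z_3^{k+1}=0$. A $1$-parameter family $(X(t),\Lambda(t),P(t))$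 is parametrized by $t$ in an open disc around $0$ in $\mathbb{C}$ (of some positive radius); $X(t)$ is the surface defined by a nonzero form of degree $d$ in four variables whose coefficients depend holomorphically on $t$, and the line $\Lambda(t)\subset\mathbb{P}^3$ and the point $P(t)\in\mathbb{P}^3$ depend holomorphically on $t$. *)

theory Defs
  imports
    "HOL-Complex_Analysis.Complex_Analysis"
    "HOL-Library.Poly_Mapping"
    "HOL-Library.Numeral_Type"
    "HOL-Computational_Algebra.Factorial_Ring"
begin

section \<open>Complex polynomials in finitely many variables\<close>

text \<open>
  The polynomial ring over the complex numbers in the variables indexed by a type: a polynomial
  maps exponent vectors to coefficients, with finite support.
\<close>

type_synonym 'n cpoly = "('n \<Rightarrow>\<^sub>0 nat) \<Rightarrow>\<^sub>0 complex"

definition peval :: "'n::finite cpoly \<Rightarrow> complex ^ 'n \<Rightarrow> complex" where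
  "peval F x = (\<Sum>m\<in>Poly_Mapping.keys F.
     Poly_Mapping.lookup F m * (\<Prod>i\<in>UNIV. (x $ i) ^ Poly_Mapping.lookup m i))"

definition form :: "nat \<Rightarrow> 'n::finite cpoly \<Rightarrow> bool" where
  "form d F \<longleftrightarrow> F \<noteq> 0 \<and>
     (\<forall>m\<in>Poly_Mapping.keys F. (\<Sum>i\<in>UNIV. Poly_Mapping.lookup m i) = d)"

definition not_involving :: "'n \<Rightarrow> 'n cpoly \<Rightarrow> bool" where
  "not_involving i F \<longleftrightarrow> (\<forall>m\<in>Poly_Mapping.keys F. Poly_Mapping.lookup m i = 0)"

definition partial :: "'n::finite \<Rightarrow> 'n cpoly \<Rightarrow> complex ^ 'n \<Rightarrow> complex" where
  "partial i F x = deriv (\<lambda>s. peval F (x + axis i s)) 0"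

section \<open>Points, lines, planes and surfaces in projective 3-space\<close>

text \<open>
  A linear subspace of projective 3-space is identified with the corresponding linear subspace of
  \<open>\<complex>\<^sup>4\<close>, of (vector space) dimension one more. Incidence is inclusion.
  A surface of degree \<open>d\<close> is given by a nonzero form of degree \<open>d\<close> in four variables; it is
  irreducible and reduced iff that form is an irreducible polynomial.
\<close>

type_synonym proj_subspace = "(complex ^ 4) set"

definition proj_point :: "proj_subspace \<Rightarrow> bool" where
  "proj_point P \<longleftrightarrow> vec.subspace P \<and> vec.dim P = 1"

definition proj_line :: "proj_subspace \<Rightarrow> bool" where
  "proj_line L \<longleftrightarrow> vec.subspace L \<and> vec.dim L = 2"

definition proj_plane :: "proj_subspace \<Rightarrow> bool" where
  "proj_plane E \<longleftrightarrow> vec.subspace E \<and> vec.dim E = 3"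

definition lies_on :: "proj_subspace \<Rightarrow> 4 cpoly \<Rightarrow> bool" where
  "lies_on L F \<longleftrightarrow> (\<forall>x\<in>L. peval F x = 0)"

definition Sing :: "4 cpoly \<Rightarrow> proj_subspace set" where
  "Sing F = {Q. proj_point Q \<and> lies_on Q F \<and> (\<forall>x\<in>Q - {0}. \<forall>i. partial i F x = 0)}"

definition lin_comb :: "complex ^ 4 ^ 3 \<Rightarrow> complex ^ 3 \<Rightarrow> complex ^ 4" where
  "lin_comb b y = (\<Sum>i\<in>UNIV. (y $ i) *s (b $ i))"

section \<open>Star points\<close>

text \<open>
  The rows of \<open>b\<close> form a basis of the plane \<open>E\<close>, giving the homogeneous coordinates
  \<open>(Y\<^sub>0 : Y\<^sub>1 : Y\<^sub>2)\<close> on \<open>E\<close> with \<open>P = (1 : 0 : 0)\<close>; \<open>G\<close> is the restriction of \<open>F\<close> to \<open>E\<close> in these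
  coordinates.
\<close>

definition cone_section :: "nat \<Rightarrow> 4 cpoly \<Rightarrow> proj_subspace \<Rightarrow> proj_subspace \<Rightarrow> bool" where
  "cone_section d F E P \<longleftrightarrow>
     (\<exists>(b :: complex ^ 4 ^ 3) (G :: 3 cpoly).
        vec.span (range (($) b)) = E \<and> vec.span {b $ 0} = P \<and>
        form d G \<and> not_involving 0 G \<and> (\<forall>y. peval F (lin_comb b y) = peval G y))"

definition star_point :: "nat \<Rightarrow> 4 cpoly \<Rightarrow> proj_subspace \<Rightarrow> bool" where
  "star_point d F P \<longleftrightarrow>
     d \<ge> 3 \<and> form d F \<and> irreducible F \<and> proj_point P \<and> lies_on P F \<and>
     (\<exists>E. proj_plane E \<and> cone_section d F E P)"

definition smooth_star_point :: "nat \<Rightarrow> 4 cpoly \<Rightarrow> proj_subspace \<Rightarrow> bool" where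
  "smooth_star_point d F P \<longleftrightarrow> star_point d F P \<and> P \<notin> Sing F"

section \<open>Holomorphic maps in several variables and $A_k$-singularities\<close>

text \<open>Holomorphy is complex (Frechet) differentiability at every point of an open set.\<close>

definition mholomorphic_on :: "(complex ^ 'n \<Rightarrow> complex) \<Rightarrow> (complex ^ 'n) set \<Rightarrow> bool" where
  "mholomorphic_on f U \<longleftrightarrow> open U \<and>
     (\<forall>x\<in>U. \<exists>g :: complex ^ 'n. (f has_derivative (\<lambda>h. \<Sum>i\<in>UNIV. g $ i * h $ i)) (at x))"

definition biholomorphic ::
  "(complex ^ 'n) set \<Rightarrow> (complex ^ 'n) set \<Rightarrow> (complex ^ 'n \<Rightarrow> complex ^ 'n) \<Rightarrow> bool" where
  "biholomorphic U V f \<longleftrightarrow>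
     (\<forall>i. mholomorphic_on (\<lambda>z. f z $ i) U) \<and>
     (\<exists>g. (\<forall>i. mholomorphic_on (\<lambda>w. g w $ i) V) \<and>
          (\<forall>z\<in>U. f z \<in> V \<and> g (f z) = z) \<and> (\<forall>w\<in>V. g w \<in> U \<and> f (g w) = w))"

text \<open>
  The map \<open>w \<mapsto> p + lin_comb b w\<close> is an affine chart of projective 3-space centered at the point
  spanned by \<open>p\<close>, and \<open>f\<close> changes from the local analytic coordinates \<open>z\<close> to the affine ones.
  The nowhere vanishing factor \<open>u\<close> expresses that the two local equations define the same
  (scheme) germ, not merely the same zero set.
\<close>

definition A_singularity :: "nat \<Rightarrow> 4 cpoly \<Rightarrow> proj_subspace \<Rightarrow> bool" where
  "A_singularity k F P \<longleftrightarrow> k \<ge> 1 \<and>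
     (\<exists>(p :: complex ^ 4) (b :: complex ^ 4 ^ 3) U V f u.
        p \<noteq> 0 \<and> P = vec.span {p} \<and> vec.span (insert p (range (($) b))) = UNIV \<and>
        biholomorphic U V f \<and> 0 \<in> U \<and> 0 \<in> V \<and> f 0 = 0 \<and>
        mholomorphic_on u U \<and>
        (\<forall>z\<in>U. u z \<noteq> 0 \<and>
           peval F (p + lin_comb b (f z)) = u z * ((z $ 1)\<^sup>2 + (z $ 2)\<^sup>2 + (z $ 3) ^ (k + 1))))"

section \<open>One-parameter families\<close>

text \<open>
  A family of \<open>k\<close>-dimensional linear subspaces is holomorphic if locally on the parameter domain it
  is spanned by a frame of holomorphic vector functions, i.e. if the map to the Grassmannian is
  holomorphic.
\<close>

definition holomorphic_subspaces ::
  "nat \<Rightarrow> complex set \<Rightarrow> (complex \<Rightarrow> proj_subspace) \<Rightarrow> bool" where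
  "holomorphic_subspaces k D L \<longleftrightarrow>
     (\<forall>t0\<in>D. \<exists>N (v :: nat \<Rightarrow> complex \<Rightarrow> complex ^ 4).
        open N \<and> t0 \<in> N \<and> N \<subseteq> D \<and>
        (\<forall>j<k. \<forall>i. (\<lambda>t. v j t $ i) holomorphic_on N) \<and>
        (\<forall>t\<in>N. L t = vec.span ((\<lambda>j. v j t) ` {..<k}) \<and> vec.dim (L t) = k))"

definition one_parameter_family ::
  "nat \<Rightarrow> real \<Rightarrow> (complex \<Rightarrow> 4 cpoly) \<Rightarrow> (complex \<Rightarrow> proj_subspace) \<Rightarrow>
     (complex \<Rightarrow> proj_subspace) \<Rightarrow> bool" where
  "one_parameter_family d r F L P \<longleftrightarrow> r > 0 \<and>
     (\<forall>t\<in>ball 0 r. form d (F t)) \<and>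
     (\<forall>m. (\<lambda>t. Poly_Mapping.lookup (F t) m) holomorphic_on ball 0 r) \<and>
     holomorphic_subspaces 2 (ball 0 r) L \<and>
     holomorphic_subspaces 1 (ball 0 r) P"

end

theory Submission
  imports Defs
begin

text \<open>
  Since \<open>P\<close> is smooth, the plane of the star point is the tangent plane at \<open>P\<close>, so it contains \<open>L\<close>.
  Choose a basis \<open>v\<^sub>0, v\<^sub>1, v\<^sub>2, v\<^sub>3\<close> of \<open>\<complex>\<^sup>4\<close> with \<open>P\<close> spanned by \<open>v\<^sub>0\<close>, \<open>L\<close> by \<open>v\<^sub>0, v\<^sub>1\<close> and the plane
  by \<open>v\<^sub>0, v\<^sub>1, v\<^sub>3\<close>. In the dual coordinates \<open>F = x\<^sub>2 H + G(x\<^sub>1, x\<^sub>3)\<close>, where \<open>H\<close> restricts on \<open>L\<close> to a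
  form of degree \<open>d - 1\<close> with \<open>d - 1\<close> distinct, hence simple, zeros at the singular points. Near such
  a point, \<open>x\<^sub>2\<close>, \<open>H\<close> and \<open>x\<^sub>3\<close> are local coordinates, so the singularity has type \<open>A\<^bsub>m-1\<^esub>\<close> with \<open>m\<close>
  the order of \<open>G(1, x\<^sub>3)\<close> at \<open>0\<close>. Hence \<open>G = c x\<^sub>3\<^sup>d\<close> with \<open>c \<noteq> 0\<close>, and in the family
  \<open>F + t x\<^sub>3\<^bsup>d-1\<^esup> x\<^sub>1\<close> with constant \<open>L\<close> and \<open>P\<close> the same points are of type \<open>A\<^bsub>d-2\<^esub>\<close> for \<open>t \<noteq> 0\<close>.
  The members of the family are irreducible because a form with a smooth star point always is.
\<close>

section \<open>Polynomial functions\<close>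

no_notation fps_nth (infixl \<open>$\<close> 75)

text \<open>The hypothesis supplies unknown analytic coordinates at each singular point, and these
  are hard to compare with \<open>x_2\<close>, \<open>H\<close>, \<open>x_3\<close> directly. Only
  one consequence of type \<open>A_k\<close> is therefore extracted: a smooth arc along which the
  differential of \<open>F\<close> is \<open>O(s^k)\<close>. For \<open>k = d - 1\<close> this
  bounds the order of \<open>G(1, x_3)\<close> from below by \<open>d\<close>, and the degree bound
  \<open>d\<close> turns it into an equality. In the opposite direction the coordinates can be
  written down, and the inverse function theorem makes them a chart. The number of singular points
  matters for the simplicity of the zeros. Restricted to \<open>L\<close>, \<open>H\<close> is the
  derivative of \<open>F\<close> transversal to the tangent plane; its leading coefficient is the
  value of that derivative at \<open>P\<close>, nonzero by smoothness. So its degree is exactly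
  \<open>d - 1\<close>, the given points exhaust its roots, and each root is simple. The order of
  \<open>G\<close> is then read off at a single one of them.\<close>

lemma peval_finite:
  assumes "finite K" "Poly_Mapping.keys F \<subseteq> K"
  shows "peval F x = (\<Sum>m\<in>K. Poly_Mapping.lookup F m * (\<Prod>i\<in>UNIV. (x $ i) ^ Poly_Mapping.lookup m i))"
  unfolding peval_def using assms
  by (intro sum.mono_neutral_left) (auto simp: in_keys_iff)

lemma peval_single: "peval (Poly_Mapping.single m c) x = c * (\<Prod>i\<in>UNIV. (x $ i) ^ Poly_Mapping.lookup m i)"
  by (subst peval_finite[of "{m}"]) (auto)

lemma peval_0 [simp]: "peval 0 x = 0"
  by (simp add: peval_def)

lemma peval_add [simp]: "peval (F + G) x = peval F x + peval G x"
proof -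
  let ?K = "Poly_Mapping.keys F \<union> Poly_Mapping.keys G"
  have "Poly_Mapping.keys (F + G) \<subseteq> ?K" by (rule Poly_Mapping.keys_add)
  then show ?thesis
    by (simp add: peval_finite[of ?K] lookup_add algebra_simps sum.distrib)
qed

lemma peval_sum [simp]: "peval (\<Sum>a\<in>A. f a) x = (\<Sum>a\<in>A. peval (f a) x)"
  by (induction A rule: infinite_finite_induct) auto

lemma poly_mapping_eq_sum_single:
  "F = (\<Sum>m\<in>Poly_Mapping.keys F. Poly_Mapping.single m (Poly_Mapping.lookup F m))"
proof (rule poly_mapping_eqI)
  fix k
  show "Poly_Mapping.lookup F k = Poly_Mapping.lookup (\<Sum>m\<in>Poly_Mapping.keys F. Poly_Mapping.single m (Poly_Mapping.lookup F m)) k"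
    by (cases "k \<in> Poly_Mapping.keys F")
       (auto simp: lookup_sum lookup_single when_def in_keys_iff)
qed

lemma peval_mult [simp]: "peval (F * G) x = peval F x * peval G x"
proof -
  let ?e = "\<lambda>m. \<Prod>i\<in>UNIV. (x $ i) ^ Poly_Mapping.lookup m i"
  let ?s = "\<lambda>F m. Poly_Mapping.single m (Poly_Mapping.lookup F m)"
  have "F * G = (\<Sum>m\<in>Poly_Mapping.keys F. ?s F m) * (\<Sum>n\<in>Poly_Mapping.keys G. ?s G n)"
    using poly_mapping_eq_sum_single[of F] poly_mapping_eq_sum_single[of G] by simp
  also have "\<dots> = (\<Sum>m\<in>Poly_Mapping.keys F. \<Sum>n\<in>Poly_Mapping.keys G. ?s F m * ?s G n)"
    by (rule sum_product)
  finally have eq: "F * G = (\<Sum>m\<in>Poly_Mapping.keys F. \<Sum>n\<in>Poly_Mapping.keys G. ?s F m * ?s G n)" .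
  have "peval (F * G) x = (\<Sum>m\<in>Poly_Mapping.keys F. \<Sum>n\<in>Poly_Mapping.keys G.
      (Poly_Mapping.lookup F m * ?e m) * (Poly_Mapping.lookup G n * ?e n))"
    by (subst eq) (simp add: mult_single peval_single lookup_add power_add prod.distrib mult_ac)
  also have "\<dots> = peval F x * peval G x"
    by (simp add: peval_def sum_product)
  finally show ?thesis .
qed

section \<open>Generators of the polynomial ring, identity of polynomials, homogeneity\<close>

definition pconst :: "complex \<Rightarrow> 'n::finite cpoly" where
  "pconst c = Poly_Mapping.single 0 c"

definition pvar :: "'n \<Rightarrow> 'n::finite cpoly" where
  "pvar i = Poly_Mapping.single (Poly_Mapping.single i 1) 1"

lemma peval_pconst [simp]: "peval (pconst c) x = c"
  by (simp add: pconst_def peval_single)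

lemma peval_1 [simp]: "peval 1 x = 1"
  using peval_pconst[of 1 x] by (simp add: pconst_def)

lemma peval_pvar [simp]: "peval (pvar i) x = x $ i"
proof -
  have "(\<Prod>j\<in>UNIV. (x $ j) ^ (Poly_Mapping.lookup (Poly_Mapping.single i 1) j)) = (\<Prod>j\<in>UNIV. if i = j then x $ j else 1)"
    by (intro prod.cong) (auto simp: lookup_single when_def)
  then show ?thesis by (simp add: pvar_def peval_single)
qed

lemma peval_power [simp]: "peval (F ^ n) x = peval F x ^ n"
  by (induction n) auto

lemma peval_diff [simp]: "peval (F - G) x = peval F x - peval G x"
  using peval_add[of "F - G" G x] by (simp add: algebra_simps)

lemma single_eq_prod_pvar:
  fixes m :: "'n::finite \<Rightarrow>\<^sub>0 nat"
  shows "Poly_Mapping.single m c = pconst c * (\<Prod>i\<in>UNIV. pvar i ^ Poly_Mapping.lookup m i)"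
proof -
  have pw: "pvar i ^ k = Poly_Mapping.single (Poly_Mapping.single i k) 1" for i :: 'n and k
    by (induction k) (auto simp: pvar_def mult_single simp flip: single_add)
  have pr: "(\<Prod>i\<in>A. Poly_Mapping.single (h i) (1::complex)) = Poly_Mapping.single (\<Sum>i\<in>A. h i) 1"
    if "finite A" for A :: "'n set" and h :: "'n \<Rightarrow> ('n \<Rightarrow>\<^sub>0 nat)"
    using that by (induction A rule: finite_induct) (auto simp: mult_single)
  have "(\<Sum>i\<in>UNIV. Poly_Mapping.single i (Poly_Mapping.lookup m i)) = m"
    by (rule poly_mapping_eqI) (simp add: lookup_sum lookup_single when_def)
  then show ?thesis
    by (simp add: pw pr pconst_def mult_single)
qed

text \<open>Existence statements stable under sums and products (derivatives, restriction to a line,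
  division by a linear form) follow from this without any handling of exponents.\<close>

lemma cpoly_induct [case_names const var add mult]:
  fixes F :: "'n::finite cpoly"
  assumes "\<And>c. Q (pconst c)" "\<And>i. Q (pvar i)"
    and add: "\<And>F G. Q F \<Longrightarrow> Q G \<Longrightarrow> Q (F + G)" and mult: "\<And>F G. Q F \<Longrightarrow> Q G \<Longrightarrow> Q (F * G)"
  shows "Q F"
proof -
  have 0: "Q 0" and 1: "Q 1"
    using assms(1)[of 0] assms(1)[of 1] by (simp_all add: pconst_def)
  have pw: "Q (pvar i ^ k)" for i k
    by (induction k) (auto intro: 1 mult assms(2))
  have pr: "Q (\<Prod>i\<in>A. pvar i ^ k i)" for A k
    by (induction A rule: infinite_finite_induct) (auto intro: 1 mult pw)
  have sm: "Q (\<Sum>m\<in>A. Poly_Mapping.single m (k m))" for A k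
    by (induction A rule: infinite_finite_induct)
       (auto intro!: 0 add mult assms(1) pr simp: single_eq_prod_pvar)
  show ?thesis
    by (subst poly_mapping_eq_sum_single) (rule sm)
qed

text \<open>
  Dedekind's argument: monomials are distinct multiplicative characters, hence linearly independent.
\<close>

lemma monomials_independent:
  fixes K :: "('n::finite \<Rightarrow>\<^sub>0 nat) set"
  assumes "finite K"
    and "\<forall>x :: complex ^ 'n. (\<Sum>m\<in>K. c m * (\<Prod>i\<in>UNIV. (x $ i) ^ Poly_Mapping.lookup m i)) = 0"
    and "k \<in> K"
  shows "c k = 0"
  using assms
proof (induction K arbitrary: c k rule: finite_induct)
  case (insert a K)
  let ?e = "\<lambda>m (x :: complex ^ 'n). \<Prod>i\<in>UNIV. (x $ i) ^ Poly_Mapping.lookup m i"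
  have e_mult: "?e m (\<chi> i. x $ i * y $ i) = ?e m x * ?e m y" for m x y
    by (simp add: power_mult_distrib prod.distrib)
  have tot: "c a * ?e a x + (\<Sum>m\<in>K. c m * ?e m x) = 0" for x
    using insert.prems(1)[rule_format, of x] insert.hyps by simp
  \<comment> \<open>The relation at the componentwise product of \<open>x\<close> and
    \<open>y\<close>, minus \<open>?e a y\<close> times the relation at \<open>x\<close>: the
    monomial \<open>a\<close> cancels.\<close>
  have "(\<Sum>m\<in>K. c m * (?e m y - ?e a y) * ?e m x) = 0" for x y
  proof -
    have "(\<Sum>m\<in>K. c m * (?e m y - ?e a y) * ?e m x) =
      (\<Sum>m\<in>K. c m * (?e m x * ?e m y)) - ?e a y * (\<Sum>m\<in>K. c m * ?e m x)"
      by (simp add: sum_subtractf sum_distrib_left algebra_simps)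
    also have "\<dots> = 0"
      using tot[of "\<chi> i. x $ i * y $ i"] tot[of x] unfolding e_mult by algebra
    finally show ?thesis .
  qed
  then have K: "c m * (?e m y - ?e a y) = 0" if "m \<in> K" for m y
    using insert.IH[where c = "\<lambda>m. c m * (?e m y - ?e a y)"] that by blast
  have cK: "c m = 0" if m: "m \<in> K" for m
  proof -
    have "m \<noteq> a" using m insert.hyps by auto
    then obtain i where i: "Poly_Mapping.lookup m i \<noteq> Poly_Mapping.lookup a i"
      by (meson poly_mapping_eqI)
    have "?e n (\<chi> j. if j = i then 2 else 1) = 2 ^ Poly_Mapping.lookup n i" for n
    proof -
      have "?e n (\<chi> j. if j = i then 2 else 1) = (\<Prod>j\<in>UNIV. if j = i then 2 ^ Poly_Mapping.lookup n i else 1)"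
        by (intro prod.cong) auto
      then show ?thesis by simp
    qed
    moreover have "(2::complex) ^ Poly_Mapping.lookup m i \<noteq> 2 ^ Poly_Mapping.lookup a i"
    proof
      assume "(2::complex) ^ Poly_Mapping.lookup m i = 2 ^ Poly_Mapping.lookup a i"
      then have "norm ((2::complex) ^ Poly_Mapping.lookup m i) = norm ((2::complex) ^ Poly_Mapping.lookup a i)"
        by simp
      then show False using i by (simp add: norm_power)
    qed
    ultimately show ?thesis using K[OF m, of "\<chi> j. if j = i then 2 else 1"] by auto
  qed
  have "c a = 0"
    using tot[of "\<chi> i. 1"] cK by simp
  then show ?case using insert.prems cK by auto
qed auto

lemma cpoly_eqI:
  assumes "\<And>x. peval F x = peval G x"
  shows "F = G"
proof -
  have "\<forall>x. peval (F - G) x = 0" using assms by simp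
  then have "Poly_Mapping.lookup (F - G) k = 0" if "k \<in> Poly_Mapping.keys (F - G)" for k
    using monomials_independent[of "Poly_Mapping.keys (F - G)" "Poly_Mapping.lookup (F - G)"] that
    by (simp add: peval_def)
  then have "Poly_Mapping.lookup (F - G) k = Poly_Mapping.lookup 0 k" for k
    by (cases "k \<in> Poly_Mapping.keys (F - G)") (auto simp: in_keys_iff)
  then have "F - G = 0" by (intro poly_mapping_eqI)
  then show ?thesis by simp
qed

lemma cpoly_nonzeroE:
  assumes "F \<noteq> 0"
  obtains x where "peval F x \<noteq> 0"
  using assms cpoly_eqI[of F 0] by auto

lemma peval_homogeneous:
  assumes "\<forall>m\<in>Poly_Mapping.keys F. (\<Sum>i\<in>UNIV. Poly_Mapping.lookup m i) = d"
  shows "peval F (a *s x) = a ^ d * peval F x"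
  unfolding peval_def sum_distrib_left
  by (intro sum.cong refl)
     (simp add: power_mult_distrib prod.distrib mult_ac assms flip: power_sum)

text \<open>Scaling by \<open>2\<close> multiplies a monomial of degree \<open>e\<close> by
  \<open>2 ^ e\<close>, and these factors differ for different \<open>e\<close>, so independence of
  monomials isolates the degree. Homogeneity thereby becomes a functional equation, the shape used
  from here on.\<close>

lemma form_iff: "form d F \<longleftrightarrow> F \<noteq> 0 \<and> (\<forall>a x. peval F (a *s x) = a ^ d * peval F x)"
proof (intro iffI conjI)
  assume *: "F \<noteq> 0 \<and> (\<forall>a x. peval F (a *s x) = a ^ d * peval F x)"
  have "(\<Sum>i\<in>UNIV. Poly_Mapping.lookup m i) = d" if m: "m \<in> Poly_Mapping.keys F" for m
  proof -
    let ?deg = "\<lambda>m. \<Sum>i\<in>UNIV. Poly_Mapping.lookup m i"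
    let ?e = "\<lambda>m (x :: complex ^ _). \<Prod>i\<in>UNIV. (x $ i) ^ Poly_Mapping.lookup m i"
    have "(\<Sum>m\<in>Poly_Mapping.keys F. (Poly_Mapping.lookup F m * (2 ^ ?deg m - 2 ^ d)) * ?e m x) = 0" for x
    proof -
      have "peval F (2 *s x) - 2 ^ d * peval F x = 0" using * by simp
      then show ?thesis
        unfolding peval_def sum_distrib_left sum_subtractf[symmetric]
        by (simp add: power_mult_distrib prod.distrib algebra_simps flip: power_sum)
    qed
    then have "Poly_Mapping.lookup F m * (2 ^ ?deg m - 2 ^ d) = 0"
      using monomials_independent[of "Poly_Mapping.keys F" "\<lambda>m. Poly_Mapping.lookup F m * (2 ^ ?deg m - 2 ^ d)" m] m
      by auto
    then have "(2::complex) ^ ?deg m = 2 ^ d" using m by (simp add: in_keys_iff)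
    then have "norm ((2::complex) ^ ?deg m) = norm ((2::complex) ^ d)" by simp
    then show ?thesis by (simp add: norm_power)
  qed
  then show "form d F" using * by (simp add: form_def)
qed (auto simp: form_def peval_homogeneous)

text \<open>The coefficients of the differential are again polynomials, which later gives continuity
  of the differential and differentiability of its values along an arc.\<close>

lemma peval_derivative_exists:
  fixes F :: "'n::finite cpoly"
  shows "\<exists>D :: 'n \<Rightarrow> 'n cpoly. \<forall>x. (peval F has_derivative (\<lambda>h. \<Sum>i\<in>UNIV. peval (D i) x * h $ i)) (at x)"
proof (induction F rule: cpoly_induct)
  case (const c)
  show ?case by (rule exI[of _ "\<lambda>_. 0"]) simp
next
  case (var i)
  have "(\<Sum>j\<in>UNIV. peval (if i = j then 1 else 0) x * h $ j) = h $ i" for x h :: "complex ^ 'n"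
  proof -
    have "(\<Sum>j\<in>UNIV. peval (if i = j then 1 else 0) x * h $ j) = (\<Sum>j\<in>UNIV. if i = j then h $ j else 0)"
      by (intro sum.cong) auto
    then show ?thesis by simp
  qed
  then show ?case
    by (intro exI[of _ "\<lambda>j. if i = j then 1 else 0"]) (auto intro!: bounded_linear_imp_has_derivative bounded_linear_vec_nth)
next
  case (add F G)
  then obtain D E where
    "\<forall>x. (peval F has_derivative (\<lambda>h. \<Sum>i\<in>UNIV. peval (D i) x * h $ i)) (at x)"
    "\<forall>x. (peval G has_derivative (\<lambda>h. \<Sum>i\<in>UNIV. peval (E i) x * h $ i)) (at x)"
    by blast
  then show ?case
    by (intro exI[of _ "\<lambda>i. D i + E i"])
       (auto intro!: derivative_eq_intros simp: sum.distrib algebra_simps)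
next
  case (mult F G)
  then obtain D E where
    "\<forall>x. (peval F has_derivative (\<lambda>h. \<Sum>i\<in>UNIV. peval (D i) x * h $ i)) (at x)"
    "\<forall>x. (peval G has_derivative (\<lambda>h. \<Sum>i\<in>UNIV. peval (E i) x * h $ i)) (at x)"
    by blast
  then show ?case
    by (intro exI[of _ "\<lambda>i. F * E i + D i * G"])
       (auto intro!: derivative_eq_intros simp: sum.distrib sum_distrib_left sum_distrib_right algebra_simps)
qed

section \<open>Total differentials of polynomials\<close>

definition pdiff :: "'n::finite cpoly \<Rightarrow> complex ^ 'n \<Rightarrow> complex ^ 'n \<Rightarrow> complex" where
  "pdiff F x h = (\<Sum>i\<in>UNIV. partial i F x * h $ i)"

lemma axis_vector_mult: "axis i (s::complex) = s *s axis i 1"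
  by (simp add: vec_eq_iff axis_def)

lemma has_derivative_line:
  fixes x h :: "complex ^ 'n::finite"
  shows "((\<lambda>s. x + s *s h) has_derivative (\<lambda>s. s *s h)) F"
proof -
  have "linear (\<lambda>s. s *s h)"
    by (intro linearI) (simp_all add: vec_eq_iff algebra_simps)
  then have "bounded_linear (\<lambda>s. s *s h)"
    by (simp add: linear_conv_bounded_linear)
  then have "((\<lambda>s. s *s h) has_derivative (\<lambda>s. s *s h)) F"
    by (rule bounded_linear_imp_has_derivative)
  then show ?thesis using has_derivative_add[OF has_derivative_const[of x]] by fastforce
qed

lemma pdiff_poly_exists:
  fixes F :: "'n::finite cpoly"
  shows "\<exists>D :: 'n \<Rightarrow> 'n cpoly. (\<forall>i x. partial i F x = peval (D i) x) \<and>
    (\<forall>x. (peval F has_derivative (\<lambda>h. \<Sum>i\<in>UNIV. peval (D i) x * h $ i)) (at x))"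
proof -
  obtain D :: "'n \<Rightarrow> 'n cpoly" where
    D: "\<forall>x. (peval F has_derivative (\<lambda>h. \<Sum>i\<in>UNIV. peval (D i) x * h $ i)) (at x)"
    using peval_derivative_exists[of F] ..
  have "partial i F x = peval (D i) x" for i x
  proof -
    have ax: "(\<lambda>s. peval F (x + axis i s)) = (\<lambda>s. peval F (x + s *s axis i 1))"
      by (rule ext, subst axis_vector_mult, rule refl)
    have "((\<lambda>s. peval F (x + axis i s)) has_derivative
        (\<lambda>s. \<Sum>j\<in>UNIV. peval (D j) x * (s *s axis i 1) $ j)) (at 0)"
      using diff_chain_at[OF has_derivative_line[of x "axis i 1" "at 0"], of "peval F", OF D[rule_format]]
      unfolding ax by (simp add: o_def)
    also have "(\<lambda>s. \<Sum>j\<in>UNIV. peval (D j) x * (s *s axis i 1) $ j) = (*) (peval (D i) x)"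
    proof
      fix s
      have "(\<Sum>j\<in>UNIV. peval (D j) x * (s *s axis i 1) $ j) = (\<Sum>j\<in>UNIV. if i = j then peval (D j) x * s else 0)"
        by (intro sum.cong) (auto simp: axis_def)
      then show "(\<Sum>j\<in>UNIV. peval (D j) x * (s *s axis i 1) $ j) = peval (D i) x * s" by simp
    qed
    finally show ?thesis
      unfolding partial_def by (intro DERIV_imp_deriv) (simp add: has_field_derivative_def)
  qed
  with D show ?thesis by blast
qed

lemma has_derivative_peval: "(peval F has_derivative pdiff F x) (at x)"
proof -
  obtain D where "(\<forall>i x. partial i F x = peval (D i) x) \<and>
    (\<forall>x. (peval F has_derivative (\<lambda>h. \<Sum>i\<in>UNIV. peval (D i) x * h $ i)) (at x))"
    using pdiff_poly_exists[of F] ..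
  then show ?thesis by (simp add: pdiff_def[abs_def])
qed

lemma pdiff_as_poly:
  fixes F :: "'n::finite cpoly"
  obtains D where "\<And>x. peval D x = pdiff F x v"
proof -
  obtain D :: "'n \<Rightarrow> 'n cpoly" where "\<forall>i x. partial i F x = peval (D i) x"
    using pdiff_poly_exists by blast
  then have "peval (\<Sum>i\<in>UNIV. D i * pconst (v $ i)) x = pdiff F x v" for x
    by (simp add: pdiff_def)
  then show ?thesis using that by blast
qed

lemma pdiff_add_right: "pdiff F x (h + k) = pdiff F x h + pdiff F x k"
  by (simp add: pdiff_def algebra_simps sum.distrib)

lemma pdiff_scale_right: "pdiff F x (a *s h) = a * pdiff F x h"
  by (simp add: pdiff_def sum_distrib_left mult_ac)

lemma pdiff_0_right [simp]: "pdiff F x 0 = 0"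
  by (simp add: pdiff_def)

lemma peval_line_derivative:
  "((\<lambda>s. peval F (x + s *s h)) has_field_derivative pdiff F (x + s *s h) h) (at s)"
proof -
  have "((\<lambda>s. peval F (x + s *s h)) has_derivative (\<lambda>t. pdiff F (x + s *s h) (t *s h))) (at s)"
    using diff_chain_at[OF has_derivative_line[of x h "at s"] has_derivative_peval] by (simp add: o_def)
  then show ?thesis
    by (simp add: has_field_derivative_def pdiff_scale_right mult_commute_abs)
qed

lemma peval_line_derivative_0:
  "((\<lambda>s. peval F (x + s *s h)) has_field_derivative pdiff F x h) (at 0)"
  using peval_line_derivative[of F x h 0] by simp

lemma pdiff_eqI:
  assumes "((\<lambda>s. peval F (x + s *s h)) has_field_derivative c) (at 0)"
  shows "pdiff F x h = c"
  using DERIV_unique[OF peval_line_derivative_0 assms] .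

lemma continuous_on_peval [continuous_intros]:
  assumes "continuous_on S f"
  shows "continuous_on S (\<lambda>x. peval F (f x))"
proof -
  have "continuous_on UNIV (peval F)"
    using has_derivative_peval has_derivative_continuous by (intro continuous_at_imp_continuous_on) blast
  then show ?thesis using continuous_on_compose2[OF _ assms] by blast
qed

lemma pdiff_scale_left:
  assumes "form d F" "a \<noteq> 0"
  shows "pdiff F (a *s x) h = a ^ (d - 1) * pdiff F x h"
proof (cases d)
  \<comment> \<open>Here \<open>d - 1\<close> truncates to \<open>0\<close>; the form is constant
    and both sides vanish.\<close>
  case 0
  have c: "peval F y = peval F 0" for y
    using assms(1) 0 unfolding form_iff by (metis mult_1 power_0 vector_smult_lzero)
  have "pdiff F y h = 0" for y
    by (rule pdiff_eqI) (subst c, simp)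
  then show ?thesis by simp
next
  case (Suc n)
  \<comment> \<open>Scaling the direction along with the point makes homogeneity of \<open>F\<close>
    applicable; the surplus factor \<open>a\<close> is cancelled at the end.\<close>
  have "pdiff F (a *s x) (a *s h) = a ^ d * pdiff F x h"
  proof (rule pdiff_eqI)
    have "((\<lambda>s. a ^ d * peval F (x + s *s h)) has_field_derivative a ^ d * pdiff F x h) (at 0)"
      by (intro DERIV_cmult peval_line_derivative_0)
    moreover have "peval F (a *s x + s *s (a *s h)) = a ^ d * peval F (x + s *s h)" for s
    proof -
      have "a *s x + s *s (a *s h) = a *s (x + s *s h)"
        by (simp add: vec_eq_iff algebra_simps)
      then show ?thesis using assms(1) by (metis form_iff)
    qed
    ultimately show "((\<lambda>s. peval F (a *s x + s *s (a *s h))) has_field_derivative a ^ d * pdiff F x h) (at 0)"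
      by simp
  qed
  then show ?thesis using assms(2) Suc by (simp add: pdiff_scale_right)
qed

lemma euler_identity:
  assumes "form d F"
  shows "pdiff F x x = of_nat d * peval F x"
proof (rule pdiff_eqI)
  have *: "peval F (x + s *s x) = (1 + s) ^ d * peval F x" for s
  proof -
    have "x + s *s x = (1 + s) *s x" by (simp add: vec_eq_iff algebra_simps)
    then show ?thesis using assms by (metis form_iff)
  qed
  show "((\<lambda>s. peval F (x + s *s x)) has_field_derivative of_nat d * peval F x) (at 0)"
    unfolding * by (auto intro!: derivative_eq_intros)
qed

section \<open>Restriction to lines and division by a linear form\<close>

lemma peval_line_poly:
  fixes F :: "'n::finite cpoly"
  obtains p where "\<And>s. poly p s = peval F (x + s *s h)"
proof -
  have "\<exists>p. \<forall>s. poly p s = peval F (x + s *s h)"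
  proof (induction F rule: cpoly_induct)
    case (const c)
    show ?case by (rule exI[of _ "[:c:]"]) simp
  next
    case (var i)
    show ?case by (rule exI[of _ "[:x $ i, h $ i:]"]) simp
  next
    case (add F G)
    then obtain p q where "\<forall>s. poly p s = peval F (x + s *s h)" "\<forall>s. poly q s = peval G (x + s *s h)"
      by blast
    then show ?case by (intro exI[of _ "p + q"]) simp
  next
    case (mult F G)
    then obtain p q where "\<forall>s. poly p s = peval F (x + s *s h)" "\<forall>s. poly q s = peval G (x + s *s h)"
      by blast
    then show ?case by (intro exI[of _ "p * q"]) simp
  qed
  then show ?thesis using that by blast
qed

text \<open>By homogeneity \<open>p(s) = s^d q(1/s)\<close>, where \<open>q\<close> restricts
  \<open>F\<close> to the line with the roles of \<open>x\<close> and \<open>h\<close> exchanged; so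
  \<open>p\<close> is a reversal of \<open>q\<close> and its coefficient at \<open>d\<close> is
  \<open>q(0)\<close>. Only nonzero \<open>a\<close> are assumed because the lemma is also applied
  to a differential, whose scaling law is available for these.\<close>

lemma homogeneous_line_poly:
  fixes F :: "'n::finite cpoly"
  assumes hom: "\<And>a x. a \<noteq> 0 \<Longrightarrow> peval F (a *s x) = a ^ d * peval F x"
  obtains p where "\<And>s. poly p s = peval F (x + s *s h)" "degree p \<le> d" "coeff p d = peval F h"
proof -
  obtain p where p: "\<And>s. poly p s = peval F (x + s *s h)"
    using peval_line_poly[of F x h] by blast
  obtain q where q: "\<And>s. poly q s = peval F (h + s *s x)"
    using peval_line_poly[of F h x] by blast
  let ?e = "degree q"
  \<comment> \<open>\<open>reflect_poly q\<close> is \<open>s ^ ?e * q(1/s)\<close>. The extra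
    factor \<open>s\<close> on both sides, hidden in the two \<open>Suc\<close>, settles
    \<open>s = 0\<close>.\<close>
  have "poly (monom 1 (Suc ?e) * p) s = poly (monom 1 (Suc d) * reflect_poly q) s" for s
  proof (cases "s = 0")
    case False
    have "x + s *s h = s *s (h + inverse s *s x)"
      using False by (simp add: vec_eq_iff field_simps)
    then have "poly p s = s ^ d * poly q (inverse s)"
      using hom[OF False] p q by metis
    then show ?thesis
      using False by (simp add: poly_monom poly_reflect_poly_nz)
  qed (simp add: poly_monom)
  then have eq: "monom 1 (Suc ?e) * p = monom 1 (Suc d) * reflect_poly q"
    using poly_eq_poly_eq_iff by blast
  have cf: "coeff p n = coeff (reflect_poly q) (n + ?e - d)" if "n \<ge> d" for n
  proof -
    have "coeff p n = coeff (monom 1 (Suc ?e) * p) (n + Suc ?e)"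
      by (simp add: coeff_monom_mult)
    also have "\<dots> = coeff (reflect_poly q) (n + ?e - d)"
      unfolding eq using that by (simp add: coeff_monom_mult)
    finally show ?thesis .
  qed
  have "coeff p n = 0" if "n > d" for n
  proof -
    have "degree (reflect_poly q) < n + ?e - d"
      using degree_reflect_poly_le[of q] that by linarith
    then show ?thesis using cf[of n] that by (simp add: coeff_eq_0)
  qed
  then have "degree p \<le> d" by (intro degree_le) auto
  moreover have "coeff p d = peval F h"
    using cf[of d] q[of 0] by (simp add: coeff_reflect_poly poly_0_coeff_0)
  ultimately show ?thesis using that p by blast
qed

definition plinear :: "complex ^ 'n \<Rightarrow> 'n::finite cpoly" where
  "plinear a = (\<Sum>i\<in>UNIV. pconst (a $ i) * pvar i)"

definition dotc :: "complex ^ 'n \<Rightarrow> complex ^ 'n::finite \<Rightarrow> complex" where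
  "dotc a x = (\<Sum>i\<in>UNIV. a $ i * x $ i)"

lemma peval_plinear [simp]: "peval (plinear a) x = dotc a x"
  by (simp add: plinear_def dotc_def)

lemma dotc_add [simp]: "dotc a (x + y) = dotc a x + dotc a y"
  by (simp add: dotc_def algebra_simps sum.distrib)

lemma dotc_zero [simp]: "dotc a 0 = 0"
  by (simp add: dotc_def)

lemma dotc_scale [simp]: "dotc a (s *s x) = s * dotc a x"
  by (simp add: dotc_def sum_distrib_left mult_ac)

text \<open>Moving \<open>x\<close> by the multiple \<open>dotc a x\<close> of \<open>v\<close>
  changes a polynomial by something divisible by the linear form \<open>dotc a\<close>. With
  \<open>dotc a v = 1\<close> this is division with remainder, the remainder being the restriction
  to the hyperplane pulled back along \<open>v\<close>.\<close>

lemma cpoly_split_linear: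
  fixes F :: "'n::finite cpoly"
  obtains H where "\<And>x. peval F x = dotc a x * peval H x + peval F (x - dotc a x *s v)"
proof -
  have "\<exists>H. \<forall>x. peval F x = dotc a x * peval H x + peval F (x - dotc a x *s v)"
  proof (induction F rule: cpoly_induct)
    case (const c)
    show ?case by (rule exI[of _ 0]) simp
  next
    case (var i)
    show ?case by (rule exI[of _ "pconst (v $ i)"]) simp
  next
    case (add F G)
    then obtain H K where H: "\<forall>x. peval F x = dotc a x * peval H x + peval F (x - dotc a x *s v)"
      and K: "\<forall>x. peval G x = dotc a x * peval K x + peval G (x - dotc a x *s v)" by blast
    have "peval (F + G) x = dotc a x * peval (H + K) x + peval (F + G) (x - dotc a x *s v)" for x
    proof -
      have "peval F (x - dotc a x *s v) = peval F x - dotc a x * peval H x"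
        "peval G (x - dotc a x *s v) = peval G x - dotc a x * peval K x"
        by (metis H add_diff_cancel_left') (metis K add_diff_cancel_left')
      then show ?thesis by (simp add: algebra_simps)
    qed
    then show ?case by blast
  next
    case (mult F G)
    then obtain H K where H: "\<forall>x. peval F x = dotc a x * peval H x + peval F (x - dotc a x *s v)"
      and K: "\<forall>x. peval G x = dotc a x * peval K x + peval G (x - dotc a x *s v)" by blast
    \<comment> \<open>A twisted Leibniz rule: \<open>F - plinear a * H\<close> evaluates to
      \<open>F\<close> at the displaced point.\<close>
    have "peval (F * G) x = dotc a x * peval (H * G + (F - plinear a * H) * K) x
        + peval (F * G) (x - dotc a x *s v)" for x
    proof -
      have eq: "peval F (x - dotc a x *s v) = peval F x - dotc a x * peval H x"
        "peval G (x - dotc a x *s v) = peval G x - dotc a x * peval K x"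
        by (metis H add_diff_cancel_left') (metis K add_diff_cancel_left')
      show ?thesis
        by (simp only: peval_mult peval_add peval_diff peval_plinear eq) (simp add: algebra_simps)
    qed
    then show ?case by blast
  qed
  then show ?thesis using that by blast
qed

section \<open>Irreducibility\<close>

text \<open>
  If both factors vanished at \<open>0\<close>, then comparing them on the span of \<open>v\<close> and \<open>q\<close>, where the product
  does not depend on the coordinate along \<open>v\<close>, would make both vanish at the smooth point \<open>v\<close>. A factor
  not vanishing at \<open>0\<close> is constant on every line through \<open>0\<close> on which \<open>F\<close> is nonzero.
\<close>

lemma form_irreducible:
  fixes F :: "'n::{finite,linorder} cpoly"
  assumes F: "form d F" and d: "d \<ge> 1" and smooth: "pdiff F v w \<noteq> 0"
    and q: "peval F q \<noteq> 0" and inv: "\<And>a s. peval F (a *s q + s *s v) = peval F (a *s q)"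
  shows "irreducible F"
proof -
  have hom: "peval F (a *s x) = a ^ d * peval F x" for a x
    using F by (simp add: form_iff)
  have F0: "peval F 0 = 0"
    using hom[of 0 0] d by (simp add: power_0_left split: if_splits)
  have not_both: "\<not> (peval A 0 = 0 \<and> peval B 0 = 0)" if AB: "F = A * B" for A B
  proof
    assume 0: "peval A 0 = 0 \<and> peval B 0 = 0"
    have const: "peval A (s *s v) = peval A 0" if AB: "F = A * B" for A B s
    proof -
      \<comment> \<open>On this line \<open>F\<close> is a nonzero constant, and a factor of a
        nonzero constant polynomial is constant.\<close>
      have indep: "peval A (a *s q + s *s v) = peval A (a *s q)" if "a \<noteq> 0" for a
      proof -
        obtain p where p: "\<And>s. poly p s = peval A (a *s q + s *s v)"
          using peval_line_poly[of A "a *s q" v] by blast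
        obtain r where r: "\<And>s. poly r s = peval B (a *s q + s *s v)"
          using peval_line_poly[of B "a *s q" v] by blast
        have "poly (p * r) s = poly [:a ^ d * peval F q:] s" for s
          using inv[of a s] hom[of a q] AB by (simp add: p r)
        then have "p * r = [:a ^ d * peval F q:]"
          using poly_eq_poly_eq_iff by blast
        then have "p dvd [:a ^ d * peval F q:]" by (metis dvd_triv_left)
        moreover have "[:a ^ d * peval F q:] \<noteq> 0" using that q by simp
        ultimately have "degree p = 0"
          using dvd_imp_degree_le[of p] by fastforce
        then obtain c where "p = [:c:]" by (rule degree_eq_zeroE)
        then show ?thesis using p[of s] p[of 0] by simp
      qed
      obtain p where p: "\<And>a. poly p a = peval A (s *s v + a *s q)"
        using peval_line_poly[of A "s *s v" q] by blast
      obtain r where r: "\<And>a. poly r a = peval A (0 + a *s q)"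
        using peval_line_poly[of A 0 q] by blast
      \<comment> \<open>Both sides are polynomial in \<open>a\<close>, so equality for
        \<open>a \<noteq> 0\<close> extends to \<open>a = 0\<close>; the factor
        \<open>[:0, 1:]\<close> makes them agree there trivially until it is cancelled.\<close>
      have "poly ([:0, 1:] * p) a = poly ([:0, 1:] * r) a" for a
        using indep[of a] by (cases "a = 0") (simp_all add: p r add.commute)
      then have "[:0, 1:] * p = [:0, 1:] * r" using poly_eq_poly_eq_iff by blast
      then have "p = r" by simp
      then show ?thesis using p[of 0] r[of 0] by simp
    qed
    have "peval A v = 0" "peval B v = 0"
      using 0 const[OF AB, of 1] const[of B A 1] AB by (simp_all add: mult.commute)
    then have "((\<lambda>s. peval F (v + s *s w)) has_field_derivative 0) (at 0)"
      unfolding AB peval_mult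
      by (auto intro!: derivative_eq_intros peval_line_derivative_0)
    then show False using smooth pdiff_eqI by blast
  qed
  have unit: "A dvd 1" if AB: "F = A * B" and A0: "peval A 0 \<noteq> 0" for A B
  proof -
    have const: "peval A x = peval A 0" if Fx: "peval F x \<noteq> 0" for x
    proof -
      obtain p where p: "\<And>s. poly p s = peval A (0 + s *s x)"
        using peval_line_poly[of A 0 x] by blast
      obtain r where r: "\<And>s. poly r s = peval B (0 + s *s x)"
        using peval_line_poly[of B 0 x] by blast
      have "poly (p * r) s = poly (monom (peval F x) d) s" for s
        using hom[of s x] AB by (simp add: p r poly_monom)
      then have pr: "p * r = monom (peval F x) d"
        using poly_eq_poly_eq_iff by blast
      have p0: "poly p 0 \<noteq> 0" using p[of 0] A0 by simp
      have nz: "p \<noteq> 0" "r \<noteq> 0" using pr Fx by auto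
      \<comment> \<open>All \<open>d\<close> zeros of the monomial sit at \<open>0\<close>, where
        \<open>p\<close> does not vanish; \<open>r\<close> takes them all and leaves degree
        \<open>0\<close> for \<open>p\<close>.\<close>
      have "order 0 p = 0" using p0 by (simp add: order_root)
      moreover have "order 0 (p * r) = d"
        unfolding pr using Fx by (simp add: order_0_monom)
      ultimately have "order 0 r = d" using order_mult[of p r 0] nz by simp
      then have "d \<le> degree r" using order_degree[OF nz(2), of 0] by simp
      moreover have "degree p + degree r = d"
        using degree_mult_eq[OF nz] pr Fx by (simp add: degree_monom_eq)
      ultimately have "degree p = 0" by simp
      then obtain c where "p = [:c:]" by (rule degree_eq_zeroE)
      then show ?thesis using p[of 0] p[of 1] by simp
    qed
    \<comment> \<open>Where the first factor is not known to vanish, \<open>F\<close> does. The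
      product is therefore zero, and \<open>F\<close> cancels: the linear order on the variables
      gives a polynomial ring without zero divisors.\<close>
    have "(A - pconst (peval A 0)) * F = 0"
      by (rule cpoly_eqI) (use const in auto)
    then have "A = pconst (peval A 0)"
      using F by (auto simp: form_def)
    moreover have "pconst (peval A 0) * pconst (inverse (peval A 0)) = 1"
      using A0 by (intro cpoly_eqI) simp
    ultimately show ?thesis by (metis dvdI)
  qed
  show ?thesis
    unfolding irreducible_def
  proof (intro conjI allI impI)
    show "F \<noteq> 0" using F by (simp add: form_def)
    show "\<not> F dvd 1"
    proof
      assume "F dvd 1"
      then obtain B where "F * B = 1" by (metis dvdE)
      then have "peval F 0 * peval B 0 = 1" by (metis peval_mult peval_1)
      then show False using F0 by simp
    qed
    fix A B assume AB: "F = A * B"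
    then show "A dvd 1 \<or> B dvd 1"
      using not_both[OF AB] unit[of A B] unit[of B A] by (auto simp: mult.commute)
  qed
qed

section \<open>Holomorphic maps in several variables\<close>

lemma mholomorphic_on_open: "mholomorphic_on f U \<Longrightarrow> open U"
  by (simp add: mholomorphic_on_def)

lemma mholomorphic_on_continuous: "mholomorphic_on f U \<Longrightarrow> continuous_on U f"
  unfolding mholomorphic_on_def
  by (meson continuous_at_imp_continuous_on has_derivative_continuous)

lemma has_derivative_vecI:
  fixes f :: "'a::real_normed_vector \<Rightarrow> complex ^ 'n::finite"
  assumes "\<And>i. ((\<lambda>x. f x $ i) has_derivative (\<lambda>h. f' h $ i)) F"
  shows "(f has_derivative f') F"
proof -
  have "((\<lambda>x. \<Sum>i\<in>UNIV. axis i (f x $ i)) has_derivative (\<lambda>h. \<Sum>i\<in>UNIV. axis i (f' h $ i))) F"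
  proof (intro has_derivative_sum)
    fix i :: 'n
    have "linear (axis i :: complex \<Rightarrow> complex ^ 'n)"
      by (intro linearI) (simp_all add: vec_eq_iff axis_def)
    then have "bounded_linear (axis i :: complex \<Rightarrow> complex ^ 'n)"
      by (simp add: linear_conv_bounded_linear)
    then show "((\<lambda>x. axis i (f x $ i)) has_derivative (\<lambda>h. axis i (f' h $ i))) F"
      using assms by (rule bounded_linear.has_derivative)
  qed
  moreover have "(\<Sum>i\<in>UNIV. axis i (y $ i)) = y" for y :: "complex ^ 'n"
  proof -
    have "(\<Sum>i\<in>UNIV. axis i (y $ i)) $ j = (\<Sum>i\<in>UNIV. if j = i then y $ i else 0)" for j
      unfolding sum_component by (intro sum.cong) (auto simp: axis_def)
    then show ?thesis by (simp add: vec_eq_iff)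
  qed
  ultimately show ?thesis by simp
qed

lemma mholomorphic_on_compose:
  fixes f :: "complex ^ 'm::finite \<Rightarrow> complex ^ 'n::finite"
  assumes u: "mholomorphic_on u U" and f: "\<And>i. mholomorphic_on (\<lambda>z. f z $ i) V"
    and "\<And>z. z \<in> V \<Longrightarrow> f z \<in> U"
  shows "mholomorphic_on (\<lambda>z. u (f z)) V"
  unfolding mholomorphic_on_def
proof (intro conjI ballI)
  show "open V" using f mholomorphic_on_open by blast
  fix x assume x: "x \<in> V"
  obtain a where a: "(u has_derivative (\<lambda>h. \<Sum>i\<in>UNIV. a $ i * h $ i)) (at (f x))"
    using u assms(3)[OF x] by (auto simp: mholomorphic_on_def)
  have "\<forall>i. \<exists>g. ((\<lambda>z. f z $ i) has_derivative (\<lambda>h. \<Sum>j\<in>UNIV. g $ j * h $ j)) (at x)"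
    using f x by (auto simp: mholomorphic_on_def)
  then obtain g where g: "\<forall>i. ((\<lambda>z. f z $ i) has_derivative (\<lambda>h. \<Sum>j\<in>UNIV. g i $ j * h $ j)) (at x)"
    using choice[of "\<lambda>i g. ((\<lambda>z. f z $ i) has_derivative (\<lambda>h. \<Sum>j\<in>UNIV. g $ j * h $ j)) (at x)"] by blast
  have "(f has_derivative (\<lambda>h. \<chi> i. \<Sum>j\<in>UNIV. g i $ j * h $ j)) (at x)"
    using g by (intro has_derivative_vecI) simp
  from diff_chain_at[OF this a]
  have "((\<lambda>z. u (f z)) has_derivative (\<lambda>h. \<Sum>i\<in>UNIV. a $ i * (\<Sum>j\<in>UNIV. g i $ j * h $ j))) (at x)"
    by (simp add: o_def)
  also have "(\<lambda>h. \<Sum>i\<in>UNIV. a $ i * (\<Sum>j\<in>UNIV. g i $ j * h $ j)) =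
      (\<lambda>h. \<Sum>j\<in>UNIV. (\<chi> j. \<Sum>i\<in>UNIV. a $ i * g i $ j) $ j * h $ j)"
  proof
    fix h :: "complex ^ 'm"
    have "(\<Sum>i\<in>UNIV. a $ i * (\<Sum>j\<in>UNIV. g i $ j * h $ j)) = (\<Sum>i\<in>UNIV. \<Sum>j\<in>UNIV. a $ i * g i $ j * h $ j)"
      by (simp add: sum_distrib_left mult.assoc)
    also have "\<dots> = (\<Sum>j\<in>UNIV. \<Sum>i\<in>UNIV. a $ i * g i $ j * h $ j)"
      by (rule sum.swap)
    finally show "(\<Sum>i\<in>UNIV. a $ i * (\<Sum>j\<in>UNIV. g i $ j * h $ j)) =
      (\<Sum>j\<in>UNIV. (\<chi> j. \<Sum>i\<in>UNIV. a $ i * g i $ j) $ j * h $ j)"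
      by (simp add: sum_distrib_right)
  qed
  finally show "\<exists>b. ((\<lambda>z. u (f z)) has_derivative (\<lambda>h. \<Sum>i\<in>UNIV. b $ i * h $ i)) (at x)" by blast
qed

lemma mholomorphic_on_line:
  fixes x v :: "complex ^ 'n::finite"
  assumes "mholomorphic_on f U"
  shows "(\<lambda>s. f (x + s *s v)) holomorphic_on {s. x + s *s v \<in> U}"
proof (rule holomorphic_onI)
  fix s assume "s \<in> {s. x + s *s v \<in> U}"
  then obtain a where "(f has_derivative (\<lambda>h. \<Sum>i\<in>UNIV. a $ i * h $ i)) (at (x + s *s v))"
    using assms by (auto simp: mholomorphic_on_def)
  from diff_chain_at[OF has_derivative_line[of x v "at s"] this]
  have "((\<lambda>s. f (x + s *s v)) has_derivative (\<lambda>t. \<Sum>i\<in>UNIV. a $ i * (t * v $ i))) (at s)"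
    by (simp add: o_def)
  also have "(\<lambda>t. \<Sum>i\<in>UNIV. a $ i * (t * v $ i)) = (*) (\<Sum>i\<in>UNIV. a $ i * v $ i)"
    by (simp add: fun_eq_iff sum_distrib_left sum_distrib_right mult_ac)
  finally show "(\<lambda>s. f (x + s *s v)) field_differentiable at s within {s. x + s *s v \<in> U}"
    by (meson field_differentiable_at_within field_differentiable_def has_field_derivative_def)
qed

text \<open>Complex differentiability alone gives no control of the derivative near a point;
  Cauchy's inequality on discs of a common radius in direction \<open>v\<close> makes the bound
  uniform in the base point.\<close>

lemma mholomorphic_line_deriv_bound:
  fixes v :: "complex ^ 'n::finite"
  assumes h: "mholomorphic_on h V" and "0 \<in> V"
  obtains M e where "e > 0" "\<And>x. norm x < e \<Longrightarrow> x \<in> V \<and> (\<lambda>s. h (x + s *s v)) field_differentiable at 0 \<and>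
     norm (deriv (\<lambda>s. h (x + s *s v)) 0) \<le> M \<and> norm (h x) \<le> M"
proof -
  obtain r where r: "r > 0" "cball 0 r \<subseteq> V"
    using mholomorphic_on_open[OF h] \<open>0 \<in> V\<close> open_contains_cball by blast
  have cont: "continuous_on V h" by (rule mholomorphic_on_continuous[OF h])
  have "bounded (h ` cball 0 r)"
    using r cont by (intro compact_imp_bounded compact_continuous_image)
      (auto intro: continuous_on_subset)
  then obtain M where M: "\<And>x. norm x \<le> r \<Longrightarrow> norm (h x) \<le> M"
    unfolding bounded_iff by (metis image_eqI mem_cball_0)
  \<comment> \<open>Keeps \<open>x + s *s v\<close> in the ball of radius \<open>r\<close> when
    \<open>norm x < r / 2\<close> and \<open>norm s \<le> \<rho>\<close>; the \<open>+ 1\<close>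
    covers \<open>v = 0\<close>.\<close>
  define \<rho> where "\<rho> = r / (2 * (norm v + 1))"
  have \<rho>: "\<rho> > 0" using r by (simp add: \<rho>_def add_nonneg_pos)
  have nsc: "norm (s *s v) = norm s * norm v" for s
    by (simp add: norm_vec_def norm_mult L2_set_right_distrib)
  have small: "norm (x + s *s v) \<le> r" if "norm x < r / 2" "norm s \<le> \<rho>" for x s
  proof -
    have "norm (s *s v) \<le> \<rho> * norm v" using that by (simp add: nsc mult_right_mono)
    also have "\<dots> \<le> \<rho> * (norm v + 1)" using \<rho> by simp
    also have "\<dots> = r / 2"
      using norm_ge_zero[of v] unfolding \<rho>_def by (simp add: divide_simps) (smt (verit) norm_ge_zero)
    finally show ?thesis using norm_triangle_ineq[of x "s *s v"] that by linarith
  qed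
  show ?thesis
  proof (rule that[of "r / 2" "max M (M / \<rho>)"], use r in simp)
    fix x :: "complex ^ 'n" assume x: "norm x < r / 2"
    have sub: "cball 0 \<rho> \<subseteq> {s. x + s *s v \<in> V}"
      using small[OF x] r by (auto simp: subset_iff)
    have hol: "(\<lambda>s. h (x + s *s v)) holomorphic_on cball 0 \<rho>"
      using holomorphic_on_subset[OF mholomorphic_on_line[OF h] sub] .
    have holb: "(\<lambda>s. h (x + s *s v)) holomorphic_on ball 0 \<rho>"
      using holomorphic_on_subset[OF hol] by simp
    have "norm ((deriv ^^ 1) (\<lambda>s. h (x + s *s v)) 0) \<le> fact 1 * M / \<rho> ^ 1"
      using holb \<rho> small[OF x] M
      by (intro Cauchy_inequality holomorphic_on_imp_continuous_on[OF hol]) auto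
    moreover have "(\<lambda>s. h (x + s *s v)) field_differentiable at 0"
      using holomorphic_on_imp_differentiable_at[OF holb] \<rho> by simp
    moreover have "norm (h x) \<le> M" "x \<in> V" using M[of x] x r by (auto simp: subset_iff)
    ultimately show "x \<in> V \<and> (\<lambda>s. h (x + s *s v)) field_differentiable at 0 \<and>
     norm (deriv (\<lambda>s. h (x + s *s v)) 0) \<le> max M (M / \<rho>) \<and> norm (h x) \<le> max M (M / \<rho>)"
      by auto
  qed
qed

text \<open>The inverse function theorem over the reals provides a differentiable local inverse. Its
  derivative inverts a complex linear map, hence is complex linear, and so the inverse is
  holomorphic. \<open>J\<close> is the Jacobian matrix of \<open>\<Phi>\<close>.\<close>

lemma biholomorphicI_inverse_function:
  fixes \<Phi> :: "complex ^ 'n::finite \<Rightarrow> complex ^ 'n" and J :: "'n \<Rightarrow> 'n \<Rightarrow> complex ^ 'n \<Rightarrow> complex"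
  assumes W: "open W" "x0 \<in> W"
    and der: "\<And>i x. x \<in> W \<Longrightarrow> ((\<lambda>x. \<Phi> x $ i) has_derivative (\<lambda>h. \<Sum>j\<in>UNIV. J i j x * h $ j)) (at x)"
    and cont: "\<And>i j. continuous_on W (J i j)"
    and inj: "\<And>h. (\<And>i. (\<Sum>j\<in>UNIV. J i j x0 * h $ j) = 0) \<Longrightarrow> h = 0"
  obtains U V f where "biholomorphic U V f" "V \<subseteq> W" "\<Phi> x0 \<in> U" "x0 \<in> V" "f (\<Phi> x0) = x0"
    "\<And>z. z \<in> U \<Longrightarrow> \<Phi> (f z) = z"
proof -
  define D where "D x = (\<lambda>h::complex ^ 'n. \<chi> i. \<Sum>j\<in>UNIV. J i j x * h $ j)" for x
  have lin: "bounded_linear (D x)" for x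
  proof -
    have "linear (D x)"
      by (intro linearI) (simp_all add: D_def vec_eq_iff algebra_simps sum.distrib scaleR_sum_right)
    then show ?thesis by (simp add: linear_conv_bounded_linear)
  qed
  have app: "blinfun_apply (Blinfun (D x)) = D x" for x
    by (rule bounded_linear_Blinfun_apply[OF lin])
  have dV: "(\<Phi> has_derivative D x) (at x)" if "x \<in> W" for x
    by (rule has_derivative_vecI) (use der[OF that] in \<open>simp add: D_def\<close>)
  have contD: "continuous_on W (\<lambda>x. Blinfun (D x))"
  proof -
    have "continuous (at x within W) (\<lambda>x. Blinfun (D x))" if "x \<in> W" for x
    proof (rule continuous_blinfun_componentwiseI1)
      fix b :: "complex ^ 'n"
      have "continuous_on W (\<lambda>x. D x b)"
        unfolding D_def by (intro continuous_on_vec_lambda continuous_intros cont)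
      then show "continuous (at x within W) (\<lambda>x. blinfun_apply (Blinfun (D x)) b)"
        using that by (simp add: app continuous_on_eq_continuous_within)
    qed
    then show ?thesis by (simp add: continuous_on_eq_continuous_within)
  qed
  have "inj (D x0)"
  proof -
    have "linear (D x0)" using lin by (rule bounded_linear.linear)
    moreover have "h = 0" if "D x0 h = 0" for h
      using that inj[of h] by (simp add: D_def vec_eq_iff)
    ultimately show ?thesis by (simp add: linear_injective_0)
  qed
  then obtain G where G: "linear G" "G \<circ> D x0 = id"
    using linear_injective_left_inverse[of "D x0"] lin bounded_linear.linear by blast
  have "Blinfun G o\<^sub>L Blinfun (D x0) = id_blinfun"
  proof (rule blinfun_eqI)
    fix h
    have "bounded_linear G" using G by (simp add: linear_conv_bounded_linear)
    then show "blinfun_apply (Blinfun G o\<^sub>L Blinfun (D x0)) h = blinfun_apply id_blinfun h"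
      using G(2) by (simp add: app bounded_linear_Blinfun_apply fun_eq_iff)
  qed
  then obtain V U g g' where *: "open V" "V \<subseteq> W" "x0 \<in> V" "open U" "\<Phi> x0 \<in> U"
      "homeomorphism V U \<Phi> g"
      "\<And>y. y \<in> U \<Longrightarrow> (g has_derivative (g' y)) (at y)"
      "\<And>y. y \<in> U \<Longrightarrow> g' y = inv (blinfun_apply (Blinfun (D (g y))))"
      "\<And>y. y \<in> U \<Longrightarrow> bij (blinfun_apply (Blinfun (D (g y))))"
    using inverse_function_theorem[of W \<Phi> "\<lambda>x. Blinfun (D x)" x0 "Blinfun G"] dV W contD
    unfolding app by metis
  have hom: "\<And>x. x \<in> V \<Longrightarrow> \<Phi> x \<in> U \<and> g (\<Phi> x) = x" "\<And>y. y \<in> U \<Longrightarrow> g y \<in> V \<and> \<Phi> (g y) = y"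
    using *(6) by (auto simp: homeomorphism_def)
  have "mholomorphic_on (\<lambda>z. g z $ i) U" for i
    unfolding mholomorphic_on_def
  proof (intro conjI ballI *)
    fix y assume y: "y \<in> U"
    have bij: "bij (D (g y))" using *(9)[OF y] by (simp add: app)
    have inv: "g' y = inv (D (g y))" using *(8)[OF y] by (simp add: app)
    have Dinv: "D (g y) (g' y h) = h" for h
      unfolding inv using bij by (simp add: bij_is_surj surj_f_inv_f)
    \<comment> \<open>Complex linearity is transported from \<open>D\<close> to its inverse
      \<open>g' y\<close> by injectivity of \<open>D\<close>.\<close>
    have Dadd: "D x (h + k) = D x h + D x k" and Dsc: "D x (a *s h) = a *s D x h" for x h k a
      by (simp_all add: D_def vec_eq_iff algebra_simps sum.distrib sum_distrib_left)
    have add: "g' y (h + k) = g' y h + g' y k" for h k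
    proof -
      have "D (g y) (g' y (h + k)) = D (g y) (g' y h + g' y k)" unfolding Dadd Dinv ..
      then show ?thesis using bij by (meson bij_is_inj injD)
    qed
    have sc: "g' y (a *s h) = a *s g' y h" for a h
    proof -
      have "D (g y) (g' y (a *s h)) = D (g y) (a *s g' y h)" unfolding Dsc Dinv ..
      then show ?thesis using bij by (meson bij_is_inj injD)
    qed
    have sum: "g' y (\<Sum>j\<in>A. k j) = (\<Sum>j\<in>A. g' y (k j))" if "finite A" for A and k :: "'n \<Rightarrow> complex ^ 'n"
      using that
    proof (induction A rule: finite_induct)
      case empty
      show ?case using sc[of 0 0] by simp
    qed (simp add: add)
    have "g' y h $ i = (\<Sum>j\<in>UNIV. (\<chi> j. g' y (axis j 1) $ i) $ j * h $ j)" for h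
    proof -
      have "g' y h = g' y (\<Sum>j\<in>UNIV. h $ j *s axis j 1)"
        by (simp add: basis_expansion)
      also have "\<dots> = (\<Sum>j\<in>UNIV. h $ j *s g' y (axis j 1))"
        by (simp add: sum sc)
      finally show ?thesis by (simp add: mult.commute)
    qed
    then have lin: "(\<lambda>h. g' y h $ i) = (\<lambda>h. \<Sum>j\<in>UNIV. (\<chi> j. g' y (axis j 1) $ i) $ j * h $ j)" by blast
    have "((\<lambda>z. g z $ i) has_derivative (\<lambda>h. g' y h $ i)) (at y)"
      using bounded_linear.has_derivative[OF bounded_linear_vec_nth *(7)[OF y]] .
    then show "\<exists>a. ((\<lambda>z. g z $ i) has_derivative (\<lambda>h. \<Sum>j\<in>UNIV. a $ j * h $ j)) (at y)"
      unfolding lin by (rule exI)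
  qed
  moreover have "mholomorphic_on (\<lambda>x. \<Phi> x $ i) V" for i
    unfolding mholomorphic_on_def
  proof (intro conjI ballI *)
    fix x assume "x \<in> V"
    then have "((\<lambda>x. \<Phi> x $ i) has_derivative (\<lambda>h. \<Sum>j\<in>UNIV. (\<chi> j. J i j x) $ j * h $ j)) (at x)"
      using der[of x i] *(2) by auto
    then show "\<exists>a. ((\<lambda>z. \<Phi> z $ i) has_derivative (\<lambda>h. \<Sum>j\<in>UNIV. a $ j * h $ j)) (at x)" by blast
  qed
  ultimately have "biholomorphic U V g"
    unfolding biholomorphic_def using hom by blast
  then show ?thesis using that * hom by blast
qed

section \<open>Arcs at singular points\<close>

text \<open>The matrix with columns \<open>v j\<close> is invertible, and the rows of its inverse
  are the dual basis.\<close>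

lemma dual_basis:
  fixes v :: "'n::finite \<Rightarrow> complex ^ 'n"
  assumes "vec.span (range v) = UNIV"
  shows "\<exists>a. (\<forall>i j. dotc (a i) (v j) = (if i = j then 1 else 0)) \<and>
    (\<forall>x. x = (\<Sum>j\<in>UNIV. dotc (a j) x *s v j))"
proof -
  define A :: "complex ^ 'n ^ 'n" where "A = (\<chi> i j. v j $ i)"
  have col: "column j A = v j" for j
    by (simp add: A_def column_def vec_eq_iff)
  then have "columns A = range v" by (auto simp: columns_def)
  then obtain B where B: "A ** B = mat 1"
    using assms matrix_right_invertible_span_columns[of A] by auto
  then have B': "B ** A = mat 1" using matrix_left_right_inverse by blast
  have "dotc (B $ i) (v j) = (if i = j then 1 else 0)" for i j
  proof -
    have "dotc (B $ i) (v j) = (B ** A) $ i $ j"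
      by (simp add: dotc_def matrix_matrix_mult_def A_def)
    then show ?thesis unfolding B' by (simp add: mat_def)
  qed
  moreover have "x = (\<Sum>j\<in>UNIV. dotc (B $ j) x *s v j)" for x
  proof -
    have "(\<Sum>j\<in>UNIV. dotc (B $ j) x *s v j) = A *v (B *v x)"
      by (simp add: vec_eq_iff matrix_vector_mult_def dotc_def A_def mult.commute)
    also have "\<dots> = x"
      by (simp add: matrix_vector_mul_assoc B)
    finally show ?thesis by simp
  qed
  ultimately have "(\<forall>i j. dotc (B $ i) (v j) = (if i = j then 1 else 0)) \<and>
    (\<forall>x. x = (\<Sum>j\<in>UNIV. dotc (B $ j) x *s v j))" by (intro conjI allI)
  then show ?thesis by (rule exI[of _ "\<lambda>i. B $ i"])
qed

definition vec4 :: "'a \<Rightarrow> 'a \<Rightarrow> 'a \<Rightarrow> 'a \<Rightarrow> 4 \<Rightarrow> 'a" where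
  "vec4 a b c e i = (if i = 1 then a else if i = 2 then b else if i = 3 then c else e)"

lemma range_vec4: "range (vec4 a b c e) = {a, b, c, e}"
  unfolding UNIV_4 by (simp add: vec4_def insert_commute)

lemma dual_basis_4:
  fixes v0 v1 v2 v3 :: "complex ^ 4"
  assumes "vec.span {v0, v1, v2, v3} = UNIV"
  obtains a0 a1 a2 a3 where
    "dotc a0 v0 = 1" "dotc a0 v1 = 0" "dotc a0 v2 = 0" "dotc a0 v3 = 0"
    "dotc a1 v0 = 0" "dotc a1 v1 = 1" "dotc a1 v2 = 0" "dotc a1 v3 = 0"
    "dotc a2 v0 = 0" "dotc a2 v1 = 0" "dotc a2 v2 = 1" "dotc a2 v3 = 0"
    "dotc a3 v0 = 0" "dotc a3 v1 = 0" "dotc a3 v2 = 0" "dotc a3 v3 = 1"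
    "\<And>x. x = dotc a0 x *s v0 + dotc a1 x *s v1 + dotc a2 x *s v2 + dotc a3 x *s v3"
proof -
  have span: "vec.span (range (vec4 v0 v1 v2 v3)) = UNIV"
    using assms by (simp add: range_vec4)
  obtain a where "(\<forall>i j. dotc (a i) (vec4 v0 v1 v2 v3 j) = (if i = j then 1 else 0)) \<and>
      (\<forall>x. x = (\<Sum>j\<in>UNIV. dotc (a j) x *s vec4 v0 v1 v2 v3 j))"
    using dual_basis[OF span] ..
  then have a: "dotc (a i) (vec4 v0 v1 v2 v3 j) = (if i = j then 1 else 0)"
    "x = (\<Sum>j\<in>UNIV. dotc (a j) x *s vec4 v0 v1 v2 v3 j)" for i j x
    by (rule conjE, iprover)+
  have v: "vec4 v0 v1 v2 v3 1 = v0" "vec4 v0 v1 v2 v3 2 = v1" "vec4 v0 v1 v2 v3 3 = v2"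
    "vec4 v0 v1 v2 v3 4 = v3"
    by (simp_all add: vec4_def)
  show ?thesis
  proof (rule that[of "a 1" "a 2" "a 3" "a 4"])
    show "x = dotc (a 1) x *s v0 + dotc (a 2) x *s v1 + dotc (a 3) x *s v2 + dotc (a 4) x *s v3" for x
      using a(2)[of x] unfolding sum_4 v .
  qed (use a(1)[of _ 1] a(1)[of _ 2] a(1)[of _ 3] a(1)[of _ 4] in \<open>simp_all add: v\<close>)
qed

section \<open>Affine charts and holomorphic arcs\<close>

lemma lin_comb_add: "lin_comb b (x + y) = lin_comb b x + lin_comb b y"
  by (simp add: lin_comb_def vec_eq_iff algebra_simps sum.distrib)

lemma lin_comb_scale: "lin_comb b (a *s y) = a *s lin_comb b y"
  by (simp add: lin_comb_def vec_eq_iff sum_distrib_left mult_ac)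

lemma lin_comb_3: "lin_comb b y = y $ 1 *s b $ 1 + y $ 2 *s b $ 2 + y $ 3 *s b $ 3"
  by (simp add: lin_comb_def sum_3)

lemma lin_comb_axis: "lin_comb b (axis i 1) = b $ i"
proof -
  have "lin_comb b (axis i 1) = (\<Sum>j\<in>UNIV. if i = j then b $ j else 0)"
    unfolding lin_comb_def by (intro sum.cong) (auto simp: axis_def)
  then show ?thesis by simp
qed

lemma range_vec_3:
  fixes b :: "'a ^ 3"
  shows "range (($) b) = {b $ 1, b $ 2, b $ 3}"
  unfolding UNIV_3 by auto

lemma chart_spanning:
  fixes b :: "complex ^ 4 ^ 3"
  assumes "vec.span (insert p (range (($) b))) = (UNIV :: (complex ^ 4) set)"
  shows "\<exists>c y. x = c *s p + lin_comb b y"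
    and "c *s p + lin_comb b y = 0 \<Longrightarrow> y = 0"
proof -
  obtain a0 a1 a2 a3 where a:
    "dotc a1 p = 0" "dotc a1 (b $ 1) = 1" "dotc a1 (b $ 2) = 0" "dotc a1 (b $ 3) = 0"
    "dotc a2 p = 0" "dotc a2 (b $ 1) = 0" "dotc a2 (b $ 2) = 1" "dotc a2 (b $ 3) = 0"
    "dotc a3 p = 0" "dotc a3 (b $ 1) = 0" "dotc a3 (b $ 2) = 0" "dotc a3 (b $ 3) = 1"
    "\<And>x. x = dotc a0 x *s p + dotc a1 x *s b $ 1 + dotc a2 x *s b $ 2 + dotc a3 x *s b $ 3"
    using dual_basis_4[of p "b $ 1" "b $ 2" "b $ 3"] assms unfolding range_vec_3 by metis
  show "\<exists>c y. x = c *s p + lin_comb b y"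
    using a(13)[of x]
    by (intro exI[of _ "dotc a0 x"] exI[of _ "vector [dotc a1 x, dotc a2 x, dotc a3 x]"])
       (simp add: lin_comb_3 add.assoc)
  assume 0: "c *s p + lin_comb b y = 0"
  have "dotc a1 (c *s p + lin_comb b y) = y $ 1" "dotc a2 (c *s p + lin_comb b y) = y $ 2"
    "dotc a3 (c *s p + lin_comb b y) = y $ 3"
    by (simp_all add: lin_comb_3 a(1-12))
  then show "y = 0" unfolding 0 dotc_zero by (simp add: vec_eq_iff forall_3)
qed

lemma pdiff_sum_right: "pdiff F x (\<Sum>j\<in>A. k j) = (\<Sum>j\<in>A. pdiff F x (k j))"
  by (induction A rule: infinite_finite_induct) (simp_all add: pdiff_add_right)

lemma has_field_derivative_dotc:
  assumes "\<And>i. ((\<lambda>s. \<gamma> s $ i) has_field_derivative \<gamma>' $ i) (at s)"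
  shows "((\<lambda>s. dotc a (\<gamma> s)) has_field_derivative dotc a \<gamma>') (at s)"
  unfolding dotc_def by (intro DERIV_sum DERIV_cmult assms)

lemma mholomorphic_on_chain:
  fixes \<phi> :: "complex \<Rightarrow> complex ^ 'n::finite"
  assumes "mholomorphic_on f U" "\<phi> s \<in> U"
    and \<phi>: "\<And>i. ((\<lambda>s. \<phi> s $ i) has_field_derivative \<phi>' $ i) (at s)"
  shows "\<exists>a. ((\<lambda>s. f (\<phi> s)) has_field_derivative dotc a \<phi>') (at s)"
proof -
  obtain a where a: "(f has_derivative (\<lambda>h. \<Sum>i\<in>UNIV. a $ i * h $ i)) (at (\<phi> s))"
    using assms by (auto simp: mholomorphic_on_def)
  have "(\<phi> has_derivative (\<lambda>t. t *s \<phi>')) (at s)"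
    by (rule has_derivative_vecI)
       (use \<phi> in \<open>simp add: has_field_derivative_def mult_commute_abs\<close>)
  from diff_chain_at[OF this a]
  have "((\<lambda>s. f (\<phi> s)) has_derivative (\<lambda>t. \<Sum>i\<in>UNIV. a $ i * (t * \<phi>' $ i))) (at s)"
    by (simp add: o_def)
  also have "(\<lambda>t. \<Sum>i\<in>UNIV. a $ i * (t * \<phi>' $ i)) = (*) (dotc a \<phi>')"
    by (simp add: fun_eq_iff dotc_def sum_distrib_left sum_distrib_right mult_ac)
  finally show ?thesis by (auto simp: has_field_derivative_def)
qed

text \<open>
  The arc is the \<open>z\<^sub>3\<close>-axis of the normal form \<open>z\<^sub>1\<^sup>2 + z\<^sub>2\<^sup>2 + z\<^sub>3\<^sup>k\<^sup>+\<^sup>1\<close>: along it all partial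
  derivatives of the normal form vanish to order \<open>k\<close>, a condition that does not depend on the
  coordinates.
\<close>

lemma A_singularity_arc:
  assumes A: "A_singularity k F Q" and F: "form d F"
  obtains p \<gamma> \<gamma>' where "p \<noteq> 0" "Q = vec.span {p}" "\<gamma> 0 = p"
    "\<And>i. ((\<lambda>s. \<gamma> s $ i) has_field_derivative \<gamma>' $ i) (at 0)"
    "\<And>a. \<gamma>' \<noteq> a *s p" "\<And>h. (\<lambda>s. pdiff F (\<gamma> s) h) \<in> O[at 0](\<lambda>s. s ^ k)"
proof -
  obtain p and b :: "complex ^ 4 ^ 3" and U V f u where p: "p \<noteq> 0" "Q = vec.span {p}"
    and span: "vec.span (insert p (range (($) b))) = UNIV"
    and bi: "biholomorphic U V f" and UV: "0 \<in> U" "0 \<in> V" "f 0 = 0"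
    and u: "mholomorphic_on u U" and k: "k \<ge> 1"
    and eq: "\<And>z. z \<in> U \<Longrightarrow> peval F (p + lin_comb b (f z)) = u z * ((z $ 1)\<^sup>2 + (z $ 2)\<^sup>2 + (z $ 3) ^ (k + 1))"
    using A unfolding A_singularity_def by blast
  obtain g where f: "\<And>i. mholomorphic_on (\<lambda>z. f z $ i) U"
    and g: "\<And>i. mholomorphic_on (\<lambda>w. g w $ i) V"
    and fg: "\<And>z. z \<in> U \<Longrightarrow> f z \<in> V \<and> g (f z) = z" "\<And>w. w \<in> V \<Longrightarrow> g w \<in> U \<and> f (g w) = w"
    using bi unfolding biholomorphic_def by blast
  define e where "e s = s *s (axis 3 1 :: complex ^ 3)" for s :: complex
  have e_nth [simp]: "e s $ 1 = 0" "e s $ 2 = 0" "e s $ 3 = s" for s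
    by (simp_all add: e_def axis_def)
  have e0 [simp]: "e 0 = 0" by (simp add: e_def)
  define \<phi> where "\<phi> s = f (e s)" for s
  have opU: "open U" and opV: "open V" using u g mholomorphic_on_open by blast+
  have cont_e: "isCont e s" for s
    unfolding e_def
    using has_derivative_continuous[OF has_derivative_line[of 0 "axis 3 1" "at s"]] by simp
  have evU: "eventually (\<lambda>s. e s \<in> U) (at 0)"
    using topological_tendstoD[of e 0 "at 0" U] cont_e[of 0] opU UV by (simp add: isCont_def)
  then have evU': "eventually (\<lambda>s. e s \<in> U) (nhds 0)"
    using UV by (simp add: eventually_nhds_conv_at)
  define \<phi>' where "\<phi>' = (\<chi> i. deriv (\<lambda>s. \<phi> s $ i) 0)"
  have \<phi>': "((\<lambda>s. \<phi> s $ i) has_field_derivative \<phi>' $ i) (at 0)" for i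
  proof -
    have "(\<lambda>s. f (0 + s *s axis 3 1) $ i) holomorphic_on {s. 0 + s *s axis 3 1 \<in> U}"
      using mholomorphic_on_line[OF f] .
    moreover have "open {s. 0 + s *s (axis 3 1 :: complex ^ 3) \<in> U}"
      using open_vimage[of U e] cont_e opU
      by (simp add: vimage_def continuous_at_imp_continuous_on flip: e_def)
    ultimately have "(\<lambda>s. f (0 + s *s axis 3 1) $ i) field_differentiable at 0"
      using UV by (intro holomorphic_on_imp_differentiable_at) auto
    then show ?thesis by (simp add: field_differentiable_derivI \<phi>'_def \<phi>_def e_def)
  qed
  have \<phi>0: "\<phi> 0 = 0" by (simp add: \<phi>_def UV)
  \<comment> \<open>The third component of \<open>g\<close> along \<open>\<phi>\<close> is
    \<open>s\<close> itself; by the chain rule a vanishing tangent would give it derivative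
    \<open>0\<close>.\<close>
  have \<phi>'0: "\<phi>' \<noteq> 0"
  proof
    assume "\<phi>' = 0"
    have "\<phi> 0 \<in> V" using \<phi>0 UV by simp
    from mholomorphic_on_chain[OF g[of 3] this \<phi>']
    obtain a where "((\<lambda>s. g (\<phi> s) $ 3) has_field_derivative dotc a \<phi>') (at 0)" ..
    then have "((\<lambda>s. g (\<phi> s) $ 3) has_field_derivative 0) (at 0)"
      using \<open>\<phi>' = 0\<close> by (simp add: dotc_def)
    moreover have "eventually (\<lambda>s. s = g (\<phi> s) $ 3) (nhds 0)"
      using evU' by eventually_elim (simp add: \<phi>_def fg)
    ultimately have "((\<lambda>s. s) has_field_derivative (0::complex)) (at 0)"
      using DERIV_cong_ev[OF refl _ refl, of "\<lambda>s. s" "\<lambda>s. g (\<phi> s) $ 3" 0] by simp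
    then show False using DERIV_unique[OF DERIV_ident] by fastforce
  qed
  have contphi: "(\<phi> \<longlongrightarrow> 0) (at 0)"
  proof (rule vec_tendstoI)
    fix i
    show "((\<lambda>s. \<phi> s $ i) \<longlongrightarrow> 0 $ i) (at 0)"
      using DERIV_isCont[OF \<phi>'[of i]] \<phi>0 by (simp add: isCont_def)
  qed
  define \<gamma> where "\<gamma> s = p + lin_comb b (\<phi> s)" for s
  \<comment> \<open>On the arc \<open>z_1 = z_2 = 0\<close> and \<open>z_3 = s\<close>, so
    differentiating the normal form times the unit leaves only terms with \<open>s ^ k\<close> and
    \<open>s ^ (k + 1)\<close>. Their coefficients involve derivatives of \<open>g\<close> and
    \<open>u\<close>, bounded uniformly near the point.\<close>
  have chart_bound: "(\<lambda>s. pdiff F (\<gamma> s) (lin_comb b v)) \<in> O[at 0](\<lambda>s. s ^ k)" for v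
  proof -
    obtain M1 e1 where M1: "e1 > 0" "\<And>x. norm x < e1 \<Longrightarrow> x \<in> V \<and> (\<lambda>s. g (x + s *s v) $ 1) field_differentiable at 0"
      by (rule mholomorphic_line_deriv_bound[OF g[of 1] UV(2), of v]) blast
    obtain M2 e2 where M2: "e2 > 0" "\<And>x. norm x < e2 \<Longrightarrow> (\<lambda>s. g (x + s *s v) $ 2) field_differentiable at 0"
      by (rule mholomorphic_line_deriv_bound[OF g[of 2] UV(2), of v]) blast
    obtain M3 e3 where M3: "e3 > 0" "\<And>x. norm x < e3 \<Longrightarrow> (\<lambda>s. g (x + s *s v) $ 3) field_differentiable at 0 \<and>
       norm (deriv (\<lambda>s. g (x + s *s v) $ 3) 0) \<le> M3"
      by (rule mholomorphic_line_deriv_bound[OF g[of 3] UV(2), of v]) blast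
    have ug: "mholomorphic_on (\<lambda>w. u (g w)) V"
      using mholomorphic_on_compose[OF u g] fg by blast
    obtain M4 e4 where M4: "e4 > 0" "\<And>x. norm x < e4 \<Longrightarrow> (\<lambda>s. u (g (x + s *s v))) field_differentiable at 0 \<and>
       norm (deriv (\<lambda>s. u (g (x + s *s v))) 0) \<le> M4 \<and> norm (u (g x)) \<le> M4"
      by (rule mholomorphic_line_deriv_bound[OF ug UV(2), of v]) blast
    define \<delta> where "\<delta> = min (min e1 e2) (min e3 e4)"
    have "\<delta> > 0" using M1 M2 M3 M4 by (simp add: \<delta>_def)
    then have "eventually (\<lambda>s. norm (\<phi> s) < \<delta>) (at 0)"
      using tendstoD[OF contphi] by (simp add: dist_norm)
    moreover have "eventually (\<lambda>s::complex. norm s < 1) (at 0)"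
      unfolding eventually_at by (intro exI[of _ 1]) (simp add: dist_norm)
    ultimately have "eventually (\<lambda>s. norm (pdiff F (\<gamma> s) (lin_comb b v)) \<le> (M4 + M4 * (of_nat (k + 1) * M3)) * norm (s ^ k)) (at 0)"
      using evU
    proof eventually_elim
      case (elim s)
      define Z where "Z i \<epsilon> = g (\<phi> s + \<epsilon> *s v) $ i" for i \<epsilon>
      define W where "W \<epsilon> = u (g (\<phi> s + \<epsilon> *s v))" for \<epsilon>
      have small: "norm (\<phi> s) < e1" "norm (\<phi> s) < e2" "norm (\<phi> s) < e3" "norm (\<phi> s) < e4"
        using elim by (auto simp: \<delta>_def)
      have dZ: "(Z i has_field_derivative deriv (Z i) 0) (at 0)" if "i \<in> {1,2,3}" for i
        using that M1(2)[OF small(1)] M2(2)[OF small(2)] M3(2)[OF small(3)]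
        by (auto simp: Z_def[abs_def] field_differentiable_derivI)
      have dW: "(W has_field_derivative deriv W 0) (at 0)"
        using M4(2)[OF small(4)] by (auto simp: W_def[abs_def] field_differentiable_derivI)
      have Z0: "Z 1 0 = 0" "Z 2 0 = 0" "Z 3 0 = s"
        using fg(1)[of "e s"] elim by (auto simp: Z_def \<phi>_def)
      have bW: "norm (deriv W 0) \<le> M4" "norm (W 0) \<le> M4" "norm (deriv (Z 3) 0) \<le> M3"
        using M4(2)[OF small(4)] M3(2)[OF small(3)] by (auto simp: W_def[abs_def] Z_def[abs_def])
      define S where "S = {\<epsilon>. \<phi> s + \<epsilon> *s v \<in> V}"
      have "open S"
      proof -
        have "isCont (\<lambda>\<epsilon>. \<phi> s + \<epsilon> *s v) \<epsilon>" for \<epsilon>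
          using has_derivative_continuous[OF has_derivative_line[of "\<phi> s" v "at \<epsilon>"]] .
        then show ?thesis
          using open_vimage[of V "\<lambda>\<epsilon>. \<phi> s + \<epsilon> *s v"] opV
          by (simp add: S_def vimage_def continuous_at_imp_continuous_on)
      qed
      have "((\<lambda>\<epsilon>. W \<epsilon> * ((Z 1 \<epsilon>)\<^sup>2 + (Z 2 \<epsilon>)\<^sup>2 + (Z 3 \<epsilon>) ^ (k + 1))) has_field_derivative
          W 0 * (of_nat (k + 1) * s ^ k * deriv (Z 3) 0) + deriv W 0 * s ^ (k + 1)) (at 0)"
        by (rule derivative_eq_intros refl dZ dW | simp add: Z0)+
      then have "((\<lambda>\<epsilon>. peval F (\<gamma> s + \<epsilon> *s lin_comb b v)) has_field_derivative
          W 0 * (of_nat (k + 1) * s ^ k * deriv (Z 3) 0) + deriv W 0 * s ^ (k + 1)) (at 0)"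
      proof (rule has_field_derivative_transform_within_open[OF _ \<open>open S\<close>])
        show "0 \<in> S" using M1(2)[OF small(1)] by (simp add: S_def)
        fix \<epsilon> assume "\<epsilon> \<in> S"
        then have "g (\<phi> s + \<epsilon> *s v) \<in> U" "f (g (\<phi> s + \<epsilon> *s v)) = \<phi> s + \<epsilon> *s v"
          using fg(2) by (auto simp: S_def)
        then show "W \<epsilon> * ((Z 1 \<epsilon>)\<^sup>2 + (Z 2 \<epsilon>)\<^sup>2 + (Z 3 \<epsilon>) ^ (k + 1)) = peval F (\<gamma> s + \<epsilon> *s lin_comb b v)"
          using eq[of "g (\<phi> s + \<epsilon> *s v)"]
          by (simp add: Z_def W_def \<gamma>_def lin_comb_add lin_comb_scale add.assoc)
      qed
      then have "pdiff F (\<gamma> s) (lin_comb b v) = W 0 * (of_nat (k + 1) * s ^ k * deriv (Z 3) 0) + deriv W 0 * s ^ (k + 1)"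
        by (rule pdiff_eqI)
      then have "norm (pdiff F (\<gamma> s) (lin_comb b v)) \<le>
          norm (W 0) * (of_nat (k + 1) * norm (s ^ k) * norm (deriv (Z 3) 0)) + norm (deriv W 0) * norm (s ^ (k + 1))"
        using norm_triangle_ineq[of "W 0 * (of_nat (k + 1) * s ^ k * deriv (Z 3) 0)" "deriv W 0 * s ^ (k + 1)"]
        by (simp only: norm_mult norm_of_nat)
      also have "\<dots> \<le> M4 * (of_nat (k + 1) * norm (s ^ k) * M3) + M4 * norm (s ^ k)"
      proof (intro add_mono mult_mono bW)
        show "norm (s ^ (k + 1)) \<le> norm (s ^ k)"
          using elim by (simp add: norm_mult norm_power mult_left_le_one_le)
        show "0 \<le> M4" using order_trans[OF norm_ge_zero bW(2)] .
      qed (auto intro: order_trans[OF norm_ge_zero bW(2)])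
      finally show ?case by (simp add: algebra_simps)
    qed
    then show ?thesis by (rule bigoI)
  qed
  have dir_b: "(\<lambda>s. pdiff F (\<gamma> s) (b $ i)) \<in> O[at 0](\<lambda>s. s ^ k)" for i
    using chart_bound[of "axis i 1"] by (simp add: lin_comb_axis)
  \<comment> \<open>The direction \<open>p\<close> leaves the chart. Euler's identity expresses it
    by the chart directions and the value of \<open>F\<close>, which on the arc is a unit times
    \<open>s ^ (k + 1)\<close>.\<close>
  have dir_p: "(\<lambda>s. pdiff F (\<gamma> s) p) \<in> O[at 0](\<lambda>s. s ^ k)"
  proof -
    have eqp: "pdiff F (\<gamma> s) p = of_nat d * peval F (\<gamma> s) - (\<Sum>i\<in>UNIV. \<phi> s $ i * pdiff F (\<gamma> s) (b $ i))" for s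
    proof -
      have "pdiff F (\<gamma> s) (\<gamma> s) = pdiff F (\<gamma> s) p + (\<Sum>i\<in>UNIV. \<phi> s $ i * pdiff F (\<gamma> s) (b $ i))"
      proof -
        have "\<gamma> s = p + (\<Sum>i\<in>UNIV. \<phi> s $ i *s b $ i)" by (simp add: \<gamma>_def lin_comb_def)
        then have "pdiff F (\<gamma> s) (\<gamma> s) = pdiff F (\<gamma> s) (p + (\<Sum>i\<in>UNIV. \<phi> s $ i *s b $ i))"
          by (rule arg_cong)
        then show ?thesis by (simp add: pdiff_add_right pdiff_sum_right pdiff_scale_right)
      qed
      then show ?thesis using euler_identity[OF F] by (simp add: algebra_simps)
    qed
    have bounded: "(\<lambda>s. h s) \<in> O[at 0](\<lambda>s. 1)" if "isCont h 0" for h :: "complex \<Rightarrow> complex"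
      using that by (intro bigoI_tendsto[of _ _ "h 0"]) (auto simp: isCont_def)
    have phib: "(\<lambda>s. \<phi> s $ i) \<in> O[at 0](\<lambda>s. 1)" for i
      using bounded DERIV_isCont[OF \<phi>'] by blast
    have "(\<lambda>s. peval F (\<gamma> s)) \<in> O[at 0](\<lambda>s. s ^ k)"
    proof -
      have "isCont (\<lambda>s. u (e s)) 0"
      proof (rule isCont_o2[OF cont_e])
        show "isCont u (e 0)"
          using mholomorphic_on_continuous[OF u] opU UV by (simp add: continuous_on_eq_continuous_at)
      qed
      then have "(\<lambda>s. (u (e s) * s) * s ^ k) \<in> O[at 0](\<lambda>s. 1 * s ^ k)"
        by (intro landau_o.big.mult bounded) (auto intro: continuous_intros)
      moreover have "eventually (\<lambda>s. peval F (\<gamma> s) = (u (e s) * s) * s ^ k) (at 0)"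
        using evU by eventually_elim (simp add: \<gamma>_def \<phi>_def eq)
      ultimately show ?thesis by (simp add: landau_o.big.in_cong)
    qed
    moreover have "(\<lambda>s. \<Sum>i\<in>UNIV. \<phi> s $ i * pdiff F (\<gamma> s) (b $ i)) \<in> O[at 0](\<lambda>s. s ^ k)"
    proof (rule big_sum_in_bigo)
      fix i
      have "(\<lambda>s. \<phi> s $ i * pdiff F (\<gamma> s) (b $ i)) \<in> O[at 0](\<lambda>s. 1 * s ^ k)"
        by (intro landau_o.big.mult phib dir_b)
      then show "(\<lambda>s. \<phi> s $ i * pdiff F (\<gamma> s) (b $ i)) \<in> O[at 0](\<lambda>s. s ^ k)" by simp
    qed
    ultimately show ?thesis
      unfolding eqp by (intro sum_in_bigo) simp_all
  qed
  have bound: "(\<lambda>s. pdiff F (\<gamma> s) h) \<in> O[at 0](\<lambda>s. s ^ k)" for h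
  proof -
    obtain c y where h: "h = c *s p + lin_comb b y" using chart_spanning(1)[OF span] by blast
    show ?thesis
      unfolding h pdiff_add_right pdiff_scale_right
      using dir_p chart_bound by (intro sum_in_bigo) simp_all
  qed
  have der: "((\<lambda>s. \<gamma> s $ i) has_field_derivative lin_comb b \<phi>' $ i) (at 0)" for i
  proof -
    have "((\<lambda>s. p $ i + (\<Sum>j\<in>UNIV. \<phi> s $ j * b $ j $ i)) has_field_derivative
        0 + (\<Sum>j\<in>UNIV. \<phi>' $ j * b $ j $ i)) (at 0)"
      by (intro DERIV_add DERIV_const DERIV_sum DERIV_cmult_right \<phi>')
    then show ?thesis by (simp add: \<gamma>_def lin_comb_def)
  qed
  have indep: "lin_comb b \<phi>' \<noteq> a *s p" for a
  proof
    assume "lin_comb b \<phi>' = a *s p"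
    then have "(- a) *s p + lin_comb b \<phi>' = 0" by (simp add: vec_eq_iff)
    then show False using chart_spanning(2)[OF span] \<phi>'0 by blast
  qed
  have "\<gamma> 0 = p" by (simp add: \<gamma>_def \<phi>0 lin_comb_def)
  then show ?thesis using that p der indep bound by blast
qed

text \<open>The arc is divided by its \<open>a\<close>-coordinate. The tangent of the rescaled arc
  changes by a multiple of \<open>p\<close>, so it stays nonzero precisely because the original
  tangent was not such a multiple; homogeneity preserves the order of the differential.\<close>

lemma A_singularity_affine_arc:
  assumes A: "A_singularity k F Q" and F: "form d F"
    and a: "\<And>q. q \<in> Q \<Longrightarrow> q \<noteq> 0 \<Longrightarrow> dotc a q \<noteq> 0"
  obtains p \<gamma> \<gamma>' where "dotc a p = 1" "Q = vec.span {p}" "\<gamma> 0 = p"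
    "\<And>i. ((\<lambda>s. \<gamma> s $ i) has_field_derivative \<gamma>' $ i) (at 0)" "\<gamma>' \<noteq> 0"
    "eventually (\<lambda>s. dotc a (\<gamma> s) = 1) (nhds 0)"
    "\<And>h. (\<lambda>s. pdiff F (\<gamma> s) h) \<in> O[at 0](\<lambda>s. s ^ k)"
proof -
  obtain p \<gamma> \<gamma>' where *: "p \<noteq> 0" "Q = vec.span {p}" "\<gamma> 0 = p"
    "\<And>i. ((\<lambda>s. \<gamma> s $ i) has_field_derivative \<gamma>' $ i) (at 0)"
    "\<And>a. \<gamma>' \<noteq> a *s p" "\<And>h. (\<lambda>s. pdiff F (\<gamma> s) h) \<in> O[at 0](\<lambda>s. s ^ k)"
    using A_singularity_arc[OF A F] by blast
  have ap: "dotc a p \<noteq> 0" using a[of p] * by (simp add: vec.span_base)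
  define l where "l s = dotc a (\<gamma> s)" for s
  have dl: "(l has_field_derivative dotc a \<gamma>') (at 0)"
    unfolding l_def[abs_def] by (intro has_field_derivative_dotc *)
  have l0: "l 0 = dotc a p" by (simp add: l_def *)
  have "isCont l 0" using dl by (rule DERIV_isCont)
  then have eva: "eventually (\<lambda>s. l s \<noteq> 0) (at 0)"
    using tendsto_imp_eventually_ne[of l "l 0" "at 0" 0] ap l0 by (simp add: isCont_def)
  then have ev: "eventually (\<lambda>s. l s \<noteq> 0) (nhds 0)"
    using ap l0 by (simp add: eventually_nhds_conv_at)
  define \<delta> where "\<delta> s = inverse (l s) *s \<gamma> s" for s
  define \<delta>' where "\<delta>' = inverse (l 0) *s \<gamma>' + (- (dotc a \<gamma>' / (l 0)\<^sup>2)) *s p"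
  have "((\<lambda>s. \<delta> s $ i) has_field_derivative \<delta>' $ i) (at 0)" for i
    unfolding \<delta>_def \<delta>'_def
    by (rule derivative_eq_intros refl *(4) dl | simp add: l0 ap *(3) power2_eq_square field_simps)+
  moreover have "\<delta>' \<noteq> 0"
  proof
    assume "\<delta>' = 0"
    then have "l 0 *s \<delta>' = 0" by simp
    then have "\<gamma>' = (dotc a \<gamma>' / l 0) *s p"
      using ap l0 by (simp add: \<delta>'_def vec_eq_iff field_simps power2_eq_square)
    then show False using *(5) by blast
  qed
  moreover have "(\<lambda>s. pdiff F (\<delta> s) h) \<in> O[at 0](\<lambda>s. s ^ k)" for h
  proof -
    have "isCont (\<lambda>s. inverse (l s) ^ (d - 1)) 0"
      using \<open>isCont l 0\<close> ap l0 by (intro continuous_intros) auto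
    then have "(\<lambda>s. inverse (l s) ^ (d - 1)) \<in> O[at 0](\<lambda>s. 1)"
      by (intro bigoI_tendsto[of _ _ "inverse (l 0) ^ (d - 1)"]) (auto simp: isCont_def)
    then have "(\<lambda>s. inverse (l s) ^ (d - 1) * pdiff F (\<gamma> s) h) \<in> O[at 0](\<lambda>s. 1 * s ^ k)"
      by (intro landau_o.big.mult *)
    moreover have "eventually (\<lambda>s. pdiff F (\<delta> s) h = inverse (l s) ^ (d - 1) * pdiff F (\<gamma> s) h) (at 0)"
      using eva by eventually_elim (simp add: \<delta>_def pdiff_scale_left[OF F])
    ultimately show ?thesis by (simp add: landau_o.big.in_cong)
  qed
  moreover have "eventually (\<lambda>s. dotc a (\<delta> s) = 1) (nhds 0)"
    using ev by eventually_elim (simp add: \<delta>_def flip: l_def)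
  moreover have "Q = vec.span {inverse (l 0) *s p}"
  proof -
    have "p = l 0 *s (inverse (l 0) *s p)" using ap l0 by simp
    then have "p \<in> vec.span {inverse (l 0) *s p}" by (metis insertI1 vec.span_base vec.span_scale)
    then show ?thesis
      unfolding *(2) vec.span_eq by (simp add: vec.span_base vec.span_scale)
  qed
  moreover have "dotc a (inverse (l 0) *s p) = 1" "\<delta> 0 = inverse (l 0) *s p"
    using ap by (simp_all add: l0 \<delta>_def *)
  ultimately show ?thesis using that by blast
qed

section \<open>Orders of vanishing along an arc\<close>

lemma has_field_derivative_peval_arc:
  assumes "\<And>i. ((\<lambda>s. \<gamma> s $ i) has_field_derivative \<gamma>' $ i) (at s)"
  shows "((\<lambda>s. peval F (\<gamma> s)) has_field_derivative pdiff F (\<gamma> s) \<gamma>') (at s)"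
proof -
  have "(\<gamma> has_derivative (\<lambda>t. t *s \<gamma>')) (at s)"
    by (rule has_derivative_vecI) (use assms in \<open>simp add: has_field_derivative_def mult_commute_abs\<close>)
  from diff_chain_at[OF this has_derivative_peval]
  have "((\<lambda>s. peval F (\<gamma> s)) has_derivative (\<lambda>t. pdiff F (\<gamma> s) (t *s \<gamma>'))) (at s)"
    by (simp add: o_def)
  then show ?thesis
    by (simp add: has_field_derivative_def pdiff_scale_right mult_commute_abs)
qed

lemma isCont_pdiff:
  assumes "\<And>i. ((\<lambda>s. \<gamma> s $ i) has_field_derivative \<gamma>' $ i) (at s)"
  shows "isCont (\<lambda>s. pdiff F (\<gamma> s) h) s"
proof -
  obtain D where "\<And>x. peval D x = pdiff F x h" using pdiff_as_poly[of F h] by blast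
  then show ?thesis
    using DERIV_isCont[OF has_field_derivative_peval_arc[OF assms, of D]] by simp
qed

lemma bigo_power_null:
  fixes h :: "complex \<Rightarrow> complex"
  assumes h: "h \<in> O[at 0](\<lambda>s. s ^ k)" and n: "n < k"
  shows "((\<lambda>s. h s / s ^ n) \<longlongrightarrow> 0) (at 0)"
proof -
  obtain c where c: "eventually (\<lambda>s. norm (h s) \<le> c * norm (s ^ k)) (at 0)"
    using landau_o.bigE[OF h] by blast
  have "eventually (\<lambda>s. norm (h s / s ^ n) \<le> c * norm s ^ (k - n)) (at 0)"
    using c eventually_neq_at_within[of 0 0]
  proof eventually_elim
    case (elim s)
    have "norm (s ^ k) = norm s ^ (k - n) * norm s ^ n"
      using n by (simp add: norm_power flip: power_add)
    then show ?case
      using elim by (simp add: norm_divide norm_power divide_simps mult.assoc)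
  qed
  moreover have "((\<lambda>s::complex. c * norm s ^ (k - n)) \<longlongrightarrow> 0) (at 0)"
    using n by (auto intro!: tendsto_eq_intros)
  ultimately show ?thesis by (rule Lim_null_comparison)
qed

lemma bigo_power_0:
  fixes h :: "complex \<Rightarrow> complex"
  assumes "h \<in> O[at 0](\<lambda>s. s ^ k)" "k \<ge> 1" "isCont h 0"
  shows "h 0 = 0"
  using bigo_power_null[OF assms(1), of 0] assms(2,3) LIM_unique[of h "h 0" 0 0]
  by (simp add: isCont_def)

lemma bigo_power_derivative_0:
  fixes h :: "complex \<Rightarrow> complex"
  assumes h: "h \<in> O[at 0](\<lambda>s. s ^ k)" "k \<ge> 2" and D: "(h has_field_derivative D) (at 0)"
  shows "D = 0"
proof -
  have "h 0 = 0" using bigo_power_0[OF h(1)] h(2) DERIV_isCont[OF D] by simp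
  then have "((\<lambda>s. h s / s) \<longlongrightarrow> D) (at 0)" using D by (simp add: has_field_derivative_iff)
  moreover have "((\<lambda>s. h s / s) \<longlongrightarrow> 0) (at 0)" using bigo_power_null[OF h(1), of 1] h(2) by simp
  ultimately show ?thesis by (rule LIM_unique)
qed

text \<open>The bound of order \<open>k \<ge> 1\<close> along the arc makes the differential vanish
  at its base point, and homogeneity carries this to all nonzero vectors of
  \<open>Q\<close>.\<close>

lemma A_singularity_critical:
  assumes A: "A_singularity k F Q" and F: "form d F" and q: "q \<in> Q" "q \<noteq> 0"
  shows "pdiff F q h = 0"
proof -
  obtain p \<gamma> \<gamma>' where *: "p \<noteq> 0" "Q = vec.span {p}" "\<gamma> 0 = p"
    "\<And>i. ((\<lambda>s. \<gamma> s $ i) has_field_derivative \<gamma>' $ i) (at 0)"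
    "\<And>a. \<gamma>' \<noteq> a *s p" "\<And>h. (\<lambda>s. pdiff F (\<gamma> s) h) \<in> O[at 0](\<lambda>s. s ^ k)"
    using A_singularity_arc[OF A F] by blast
  have "k \<ge> 1" using A by (simp add: A_singularity_def)
  then have "pdiff F p h = 0"
    using bigo_power_0[OF *(6)[of h]] isCont_pdiff[OF *(4), of F h] *(3) by simp
  moreover obtain a where a: "q = a *s p"
    using q(1) *(2) by (auto simp: vec.span_singleton)
  ultimately show ?thesis
    using pdiff_scale_left[OF F, of a p h] q(2) by (cases "a = 0") auto
qed

section \<open>Coordinates adapted to a smooth star point\<close>

lemma not_involving_add: "not_involving i F \<Longrightarrow> not_involving i G \<Longrightarrow> not_involving i (F + G)"
  using Poly_Mapping.keys_add[of F G] by (auto simp: not_involving_def)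

lemma not_involving_mult: "not_involving i F \<Longrightarrow> not_involving i G \<Longrightarrow> not_involving i (F * G)"
  using keys_mult[of F G] by (fastforce simp: not_involving_def lookup_add)

lemma not_involving_pconst: "not_involving i (pconst c)"
  by (simp add: not_involving_def pconst_def)

lemma not_involving_pvar: "i \<noteq> j \<Longrightarrow> not_involving i (pvar j)"
  by (simp add: not_involving_def pvar_def lookup_single)

lemma not_involving_power:
  fixes F :: "'n::finite cpoly"
  shows "not_involving i F \<Longrightarrow> not_involving i (F ^ n)"
proof (induction n)
  case 0
  show ?case using not_involving_pconst[of i "1::complex"] by (simp add: pconst_def)
qed (simp add: not_involving_mult)

lemma not_involving_peval:
  fixes G :: "'n::finite cpoly"
  assumes "not_involving i G" and "\<And>j. j \<noteq> i \<Longrightarrow> x $ j = y $ j"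
  shows "peval G x = peval G y"
  unfolding peval_def
proof (intro sum.cong refl arg_cong2[where f = "(*)"] prod.cong)
  fix m j assume "m \<in> Poly_Mapping.keys G"
  then show "(x $ j) ^ Poly_Mapping.lookup m j = (y $ j) ^ Poly_Mapping.lookup m j"
    using assms by (cases "j = i") (auto simp: not_involving_def)
qed

lemma lookup_pconst_mult: "Poly_Mapping.lookup (pconst t * K) m = t * Poly_Mapping.lookup K m"
proof -
  have "pconst t * K = (\<Sum>m\<in>Poly_Mapping.keys K. Poly_Mapping.single m (t * Poly_Mapping.lookup K m))"
    by (subst poly_mapping_eq_sum_single[of K]) (simp add: sum_distrib_left pconst_def mult_single)
  then show ?thesis
    by (auto simp: lookup_sum lookup_single when_def in_keys_iff)
qed

lemma span_range_lin_comb: "vec.span (range (($) b)) = range (lin_comb (b :: complex ^ 4 ^ 3))"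
proof
  have "vec.subspace (range (lin_comb b))"
  proof (rule vec.subspaceI)
    show "0 \<in> range (lin_comb b)" by (rule range_eqI[of _ _ 0]) (simp add: lin_comb_def)
  next
    fix x y assume "x \<in> range (lin_comb b)" "y \<in> range (lin_comb b)"
    then obtain u w where "x = lin_comb b u" "y = lin_comb b w" by blast
    then show "x + y \<in> range (lin_comb b)" by (metis lin_comb_add rangeI)
  next
    fix c x assume "x \<in> range (lin_comb b)"
    then obtain u where "x = lin_comb b u" by blast
    then show "c *s x \<in> range (lin_comb b)" by (metis lin_comb_scale rangeI)
  qed
  moreover have "range (($) b) \<subseteq> range (lin_comb b)"
    by (metis image_subsetI lin_comb_axis rangeI)
  ultimately show "vec.span (range (($) b)) \<subseteq> range (lin_comb b)"
    by (intro vec.span_minimal)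
  have "lin_comb b y \<in> vec.span (range (($) b))" for y
    unfolding lin_comb_def by (intro vec.span_sum vec.span_scale vec.span_base rangeI)
  then show "range (lin_comb b) \<subseteq> vec.span (range (($) b))" by blast
qed

lemma dim_insert_new:
  assumes "x \<notin> vec.span S"
  shows "vec.dim (insert x S) = vec.dim S + 1"
  using assms by (simp add: vec.dim_insert)

lemma span_eq_subspace:
  assumes "vec.subspace E" "S \<subseteq> E" "vec.dim S = vec.dim E"
  shows "vec.span S = E"
  using assms by (intro vec.subspace_dim_equal vec.span_minimal) (auto simp: vec.subspace_span)

lemma span_eq_UNIV_4:
  fixes S :: "(complex ^ 4) set"
  assumes "vec.dim S = 4"
  shows "vec.span S = UNIV"
proof -
  have "vec.dim (UNIV :: (complex ^ 4) set) = 4" by (simp only: vec_dim_card) simp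
  then show ?thesis
    using assms by (intro span_eq_subspace[OF vec.subspace_UNIV subset_UNIV]) (simp only:)
qed

lemma star_point_frame:
  assumes d: "d \<ge> 3" and F: "form d F"
    and L: "proj_line L" "lies_on L F" and P: "smooth_star_point d F P" "P \<subseteq> L"
  obtains v0 v1 v2 v3 where "P = vec.span {v0}" "L = vec.span {v0, v1}"
    "vec.span {v0, v1, v2, v3} = UNIV"
    "\<And>x s. x \<in> vec.span {v0, v1, v3} \<Longrightarrow> peval F (x + s *s v0) = peval F x"
    "pdiff F v0 v2 \<noteq> 0" "\<exists>x\<in>vec.span {v0, v1, v3}. peval F x \<noteq> 0"
proof -
  obtain E where Pp: "proj_point P" "lies_on P F" and Psm: "P \<notin> Sing F"
    and E: "proj_plane E" "cone_section d F E P"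
    using P by (auto simp: smooth_star_point_def star_point_def)
  obtain b :: "complex ^ 4 ^ 3" and G where b: "vec.span (range (($) b)) = E" "vec.span {b $ 0} = P"
    and G: "form d G" "not_involving 0 G" and FG: "\<And>y. peval F (lin_comb b y) = peval G y"
    using E(2) unfolding cone_section_def by blast
  define v0 where "v0 = b $ 0"
  have P_eq: "P = vec.span {v0}" using b by (simp add: v0_def)
  have E_eq: "E = range (lin_comb b)" using b span_range_lin_comb by simp
  have sub: "vec.subspace E" "vec.subspace L" "vec.subspace P"
    and dims: "vec.dim E = 3" "vec.dim L = 2" "vec.dim P = 1"
    using E L Pp by (auto simp: proj_plane_def proj_line_def proj_point_def)
  have v0E: "v0 \<in> E" using b(1) by (auto simp: v0_def vec.span_base)
  have v0P: "v0 \<in> P" by (simp add: P_eq vec.span_base)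
  have v0L: "v0 \<in> L" using v0P P by blast
  have v0: "v0 \<noteq> 0"
  proof
    assume "v0 = 0"
    then have "vec.dim P = 0" by (simp add: P_eq)
    then show False using dims by simp
  qed
  have inv: "peval F (x + s *s v0) = peval F x" if x: "x \<in> E" for x s
  proof -
    obtain y where y: "x = lin_comb b y" using x E_eq by blast
    have "x + s *s v0 = lin_comb b (y + s *s axis 0 1)"
      by (simp add: lin_comb_add lin_comb_scale lin_comb_axis v0_def y)
    moreover have "peval G (y + s *s axis 0 1) = peval G y"
      by (rule not_involving_peval[OF G(2)]) (simp add: axis_def)
    ultimately show ?thesis by (simp add: FG y)
  qed
  \<comment> \<open>Being a cone with vertex \<open>v0\<close>, the section satisfies
    \<open>F(v0 + s h) = F(s h) = s^d F(h)\<close>, which has no linear term in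
    \<open>s\<close>.\<close>
  have tangent_E: "pdiff F v0 h = 0" if h: "h \<in> E" for h
  proof (rule pdiff_eqI)
    have "peval F (v0 + s *s h) = s ^ d * peval F h" for s
    proof -
      have "s *s h \<in> E" using h sub by (simp add: vec.subspace_scale)
      then have "peval F (v0 + s *s h) = peval F (s *s h)" using inv[of "s *s h" 1] by (simp add: add.commute)
      then show ?thesis using F by (metis form_iff)
    qed
    moreover have "((\<lambda>s. s ^ d * peval F h) has_field_derivative 0) (at 0)"
      using d by (auto intro!: derivative_eq_intros simp: power_0_left)
    ultimately show "((\<lambda>s. peval F (v0 + s *s h)) has_field_derivative 0) (at 0)" by simp
  qed
  have tangent_L: "pdiff F v0 h = 0" if h: "h \<in> L" for h
  proof (rule pdiff_eqI)
    have "peval F (v0 + s *s h) = 0" for s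
      using L(2) h v0L sub by (simp add: lies_on_def vec.subspace_add vec.subspace_scale)
    then show "((\<lambda>s. peval F (v0 + s *s h)) has_field_derivative 0) (at 0)" by simp
  qed
  obtain w where w: "pdiff F v0 w \<noteq> 0"
  proof -
    obtain x i where x: "x \<in> P" "x \<noteq> 0" "partial i F x \<noteq> 0"
      using Psm Pp by (auto simp: Sing_def)
    obtain k where k: "x = k *s v0" using x(1) P_eq by (auto simp: vec.span_singleton)
    have "pdiff F x (axis i 1) = (\<Sum>j\<in>UNIV. if i = j then partial j F x else 0)"
      unfolding pdiff_def by (intro sum.cong) (auto simp: axis_def)
    then have "pdiff F x (axis i 1) \<noteq> 0" using x by simp
    moreover have "k \<noteq> 0" using k x by auto
    ultimately have "pdiff F v0 (axis i 1) \<noteq> 0"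
      using pdiff_scale_left[OF F, of k v0] k by auto
    then show ?thesis using that by blast
  qed
  have "\<not> L \<subseteq> P" using vec.dim_subset[of L P] dims by auto
  then obtain v1 where v1: "v1 \<in> L" "v1 \<notin> P" by blast
  have dim0: "vec.dim {v0} = 1" using P_eq dims by (metis vec.dim_span)
  have dim01: "vec.dim {v1, v0} = 2"
    using dim_insert_new[of v1 "{v0}"] v1 P_eq dim0 by simp
  have L_eq: "L = vec.span {v1, v0}"
    using span_eq_subspace[of L "{v1, v0}"] sub v1 v0L dim01 dims by simp
  \<comment> \<open>Otherwise \<open>E\<close> and \<open>v1\<close> would span everything, and the
    differential at \<open>v0\<close>, zero on both, would vanish against smoothness.\<close>
  have v1E: "v1 \<in> E"
  proof (rule ccontr)
    assume "v1 \<notin> E"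
    then have "v1 \<notin> vec.span E" using sub by (simp add: vec.span_eq_iff[THEN iffD2])
    then have "vec.dim (insert v1 E) = 4" using dims by (simp add: dim_insert_new)
    then have "vec.span (insert v1 E) = UNIV"
      by (rule span_eq_UNIV_4)
    then have "w \<in> vec.span (insert v1 E)" by simp
    then obtain k where "w - k *s v1 \<in> vec.span E"
      by (auto simp: vec.span_insert)
    then have "w - k *s v1 \<in> E" using sub by (simp add: vec.span_eq_iff[THEN iffD2])
    then have "pdiff F v0 (w - k *s v1) = 0" by (rule tangent_E)
    moreover have "pdiff F v0 v1 = 0" using tangent_L v1 by blast
    moreover have "w = (w - k *s v1) + k *s v1" by simp
    ultimately have "pdiff F v0 w = 0"
      by (metis add.right_neutral mult_zero_right pdiff_add_right pdiff_scale_right)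
    then show False using w by simp
  qed
  have "\<not> E \<subseteq> L" using vec.dim_subset[of E L] dims by auto
  then obtain v3 where v3: "v3 \<in> E" "v3 \<notin> L" by blast
  have dim013: "vec.dim {v3, v1, v0} = 3"
    using dim_insert_new[of v3 "{v1, v0}"] v3 L_eq dim01 by simp
  have E_span: "E = vec.span {v3, v1, v0}"
    using span_eq_subspace[of E "{v3, v1, v0}"] sub v1E v3 v0E dim013 dims by simp
  have "w \<notin> vec.span {v3, v1, v0}" using w tangent_E E_span by blast
  then have "vec.dim {w, v3, v1, v0} = 4"
    using dim_insert_new[of w "{v3, v1, v0}"] dim013 by simp
  then have "vec.span {w, v3, v1, v0} = UNIV"
    by (rule span_eq_UNIV_4)
  then have "vec.span {v0, v1, w, v3} = UNIV"
    by (simp add: insert_commute)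
  moreover have "L = vec.span {v0, v1}" using L_eq by (simp add: insert_commute)
  moreover have E': "E = vec.span {v0, v1, v3}" using E_span by (simp add: insert_commute)
  moreover have "\<exists>x\<in>E. peval F x \<noteq> 0"
  proof -
    have "G \<noteq> 0" using G by (simp add: form_def)
    then obtain y where "peval G y \<noteq> 0" using cpoly_nonzeroE by blast
    then show ?thesis using FG E_eq by (metis rangeI)
  qed
  ultimately show ?thesis using that[of v0 v1 w v3] P_eq inv w by blast
qed

text \<open>As many roots as the degree leave no room for multiplicity: a double root in
  \<open>S\<close> would push the sum of the orders above the degree.\<close>

lemma simple_roots_of_split_poly:
  fixes p :: "'a::{idom,semiring_char_0} poly"
  assumes S: "card S = degree p" "\<And>c. c \<in> S \<Longrightarrow> poly p c = 0" and c: "c \<in> S" and "degree p \<noteq> 0"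
  shows "poly (pderiv p) c \<noteq> 0"
proof
  assume 0: "poly (pderiv p) c = 0"
  have p0: "p \<noteq> 0" and dp0: "pderiv p \<noteq> 0" using assms(4) by (auto simp: pderiv_eq_0_iff)
  have fin: "finite {x. poly p x = 0}" using p0 poly_roots_finite by blast
  have finS: "finite S" using assms(1,4) by (metis card.infinite)
  have o1: "1 \<le> order x p" if "x \<in> S" for x
    using S(2)[OF that] p0 by (simp add: order_root Suc_le_eq)
  have "1 \<le> order c (pderiv p)" using 0 dp0 by (simp add: order_root Suc_le_eq)
  then have o2: "1 < order c p" using order_pderiv[OF p0 S(2)[OF c]] by simp
  have "degree p = (\<Sum>x\<in>S. 1)" using S by simp
  also have "\<dots> < (\<Sum>x\<in>S. order x p)"
    using finS c o1 o2 by (intro sum_strict_mono_ex1) auto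
  also have "\<dots> \<le> (\<Sum>x | poly p x = 0. order x p)"
    using S fin by (intro sum_mono2) auto
  also have "\<dots> \<le> degree p" using p0 by (rule sum_order_le_degree)
  finally show False by simp
qed

text \<open>The \<open>a0\<close>, ..., \<open>a3\<close> are the coordinate functions
  \<open>x_0\<close>, ..., \<open>x_3\<close> of the overview: the tangent plane at \<open>P\<close>
  is \<open>x_2 = 0\<close> and the line is \<open>x_2 = x_3 = 0\<close>.\<close>

locale star_frame =
  fixes d :: nat and F :: "4 cpoly" and v0 v1 v2 v3 a0 a1 a2 a3 :: "complex ^ 4"
  assumes d: "d \<ge> 3" and F: "form d F"
    and span: "vec.span {v0, v1, v2, v3} = UNIV"
    and dual [simp]: "dotc a0 v0 = 1" "dotc a0 v1 = 0" "dotc a0 v2 = 0" "dotc a0 v3 = 0"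
    "dotc a1 v0 = 0" "dotc a1 v1 = 1" "dotc a1 v2 = 0" "dotc a1 v3 = 0"
    "dotc a2 v0 = 0" "dotc a2 v1 = 0" "dotc a2 v2 = 1" "dotc a2 v3 = 0"
    "dotc a3 v0 = 0" "dotc a3 v1 = 0" "dotc a3 v2 = 0" "dotc a3 v3 = 1"
    and expand: "\<And>x. x = dotc a0 x *s v0 + dotc a1 x *s v1 + dotc a2 x *s v2 + dotc a3 x *s v3"
    and line: "\<And>s y. peval F (s *s v0 + y *s v1) = 0"
    and inv: "\<And>s y z. peval F (y *s v1 + z *s v3 + s *s v0) = peval F (y *s v1 + z *s v3)"
    and smooth: "pdiff F v0 v2 \<noteq> 0"
    and nonzero: "\<exists>s y z. peval F (y *s v1 + z *s v3 + s *s v0) \<noteq> 0"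
begin

section \<open>The equation and its derivatives in the chart x_1 = 1\<close>

lemma hom: "peval F (a *s x) = a ^ d * peval F x"
  using F by (simp add: form_iff)

lemma v0_nonzero: "v0 \<noteq> 0"
  using dual(1) by (auto simp: dotc_def)

definition H :: "4 cpoly" where
  "H = (SOME H. \<forall>x. peval F x = dotc a2 x * peval H x + peval F (x - dotc a2 x *s v2))"

lemma cofactor: "peval F x = dotc a2 x * peval H x + peval F (x - dotc a2 x *s v2)"
proof -
  have "\<exists>H. \<forall>x. peval F x = dotc a2 x * peval H x + peval F (x - dotc a2 x *s v2)"
    using cpoly_split_linear[of F a2 v2] by metis
  from someI_ex[OF this] show ?thesis unfolding H_def by blast
qed

lemma F_affine:
  assumes "dotc a1 x = 1"
  shows "peval F x = dotc a2 x * peval H x + peval F (v1 + dotc a3 x *s v3)"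
proof -
  have "x - dotc a2 x *s v2 = 1 *s v1 + dotc a3 x *s v3 + dotc a0 x *s v0"
    using expand[of x] assms by (simp add: algebra_simps)
  then have "peval F (x - dotc a2 x *s v2) = peval F (1 *s v1 + dotc a3 x *s v3)"
    by (simp only: inv)
  then show ?thesis using cofactor[of x] by simp
qed

text \<open>The dehomogenised plane section \<open>G(1, x_3)\<close>; invariance along
  \<open>v0\<close> is what makes one variable enough.\<close>

definition r :: "complex poly" where
  "r = (SOME p. (\<forall>s. poly p s = peval F (v1 + s *s v3)) \<and> degree p \<le> d \<and> coeff p d = peval F v3)"

lemma section_poly: "poly r s = peval F (v1 + s *s v3)" "degree r \<le> d" "coeff r d = peval F v3"
proof -
  have "\<exists>p. (\<forall>s. poly p s = peval F (v1 + s *s v3)) \<and> degree p \<le> d \<and> coeff p d = peval F v3"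
    using homogeneous_line_poly[of F d v1 v3] hom by metis
  from someI_ex[OF this] show "poly r s = peval F (v1 + s *s v3)" "degree r \<le> d" "coeff r d = peval F v3"
    unfolding r_def by blast+
qed

text \<open>The section term depends on \<open>x_3\<close> alone, so this direction sees only the
  product \<open>x_2 H\<close>; where \<open>H\<close> has nonzero derivative along
  \<open>v0\<close>, smallness of this partial derivative is smallness of
  \<open>x_2\<close>.\<close>

lemma pdiff_v0:
  assumes x: "dotc a1 x = 1"
  shows "pdiff F x v0 = dotc a2 x * pdiff H x v0"
proof (rule pdiff_eqI)
  have "peval F (x + s *s v0) = dotc a2 x * peval H (x + s *s v0) + peval F (v1 + dotc a3 x *s v3)" for s
    using F_affine[of "x + s *s v0"] x by simp
  then show "((\<lambda>s. peval F (x + s *s v0)) has_field_derivative dotc a2 x * pdiff H x v0) (at 0)"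
    using DERIV_add[OF DERIV_cmult[OF peval_line_derivative_0] DERIV_const] by simp
qed

lemma pdiff_v2:
  assumes x: "dotc a1 x = 1"
  shows "pdiff F x v2 = peval H x + dotc a2 x * pdiff H x v2"
proof (rule pdiff_eqI)
  have eq: "peval F (x + s *s v2) = (dotc a2 x + s) * peval H (x + s *s v2) + peval F (v1 + dotc a3 x *s v3)" for s
    using F_affine[of "x + s *s v2"] x by simp
  show "((\<lambda>s. peval F (x + s *s v2)) has_field_derivative peval H x + dotc a2 x * pdiff H x v2) (at 0)"
    unfolding eq by (auto intro!: derivative_eq_intros peval_line_derivative_0)
qed

lemma pdiff_v3:
  assumes x: "dotc a1 x = 1"
  shows "pdiff F x v3 = dotc a2 x * pdiff H x v3 + poly (pderiv r) (dotc a3 x)"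
proof (rule pdiff_eqI)
  have eq: "peval F (x + s *s v3) = dotc a2 x * peval H (x + s *s v3) + poly r (dotc a3 x + s)" for s
    using F_affine[of "x + s *s v3"] x by (simp add: section_poly)
  have "((\<lambda>s. poly r (dotc a3 x + s)) has_field_derivative poly (pderiv r) (dotc a3 x)) (at 0)"
    by (auto intro!: derivative_eq_intros)
  then show "((\<lambda>s. peval F (x + s *s v3)) has_field_derivative
      dotc a2 x * pdiff H x v3 + poly (pderiv r) (dotc a3 x)) (at 0)"
    unfolding eq by (intro DERIV_add DERIV_cmult peval_line_derivative_0)
qed

text \<open>The restriction of \<open>H\<close> to the line, introduced through the differential of
  \<open>F\<close> because the homogeneity of the latter determines degree and leading
  coefficient.\<close>

definition C :: "complex poly" where
  "C = (SOME p. (\<forall>s. poly p s = pdiff F (v1 + s *s v0) v2) \<and> degree p \<le> d - 1 \<and> coeff p (d - 1) = pdiff F v0 v2)"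

lemma normal_poly: "poly C s = pdiff F (v1 + s *s v0) v2" "degree C = d - 1"
proof -
  obtain D where D: "\<And>x. peval D x = pdiff F x v2" using pdiff_as_poly[of F v2] by blast
  have "peval D (a *s x) = a ^ (d - 1) * peval D x" if "a \<noteq> 0" for a x
    using pdiff_scale_left[OF F that] by (simp add: D)
  then have "\<exists>p. (\<forall>s. poly p s = peval D (v1 + s *s v0)) \<and> degree p \<le> d - 1 \<and> coeff p (d - 1) = peval D v0"
    using homogeneous_line_poly[of D "d - 1" v1 v0] by metis
  then have "\<exists>p. (\<forall>s. poly p s = pdiff F (v1 + s *s v0) v2) \<and> degree p \<le> d - 1 \<and> coeff p (d - 1) = pdiff F v0 v2"
    by (simp add: D)
  from someI_ex[OF this] have *: "\<forall>s. poly C s = pdiff F (v1 + s *s v0) v2" "degree C \<le> d - 1" "coeff C (d - 1) = pdiff F v0 v2"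
    unfolding C_def by blast+
  show "poly C s = pdiff F (v1 + s *s v0) v2" using * by blast
  show "degree C = d - 1" using * smooth le_degree[of C "d - 1"] by simp
qed

lemma C_eq_H: "poly C s = peval H (v1 + s *s v0)"
  using pdiff_v2[of "v1 + s *s v0"] by (simp add: normal_poly)

lemma simple_root:
  assumes S: "card S = d - 1" "\<And>c. c \<in> S \<Longrightarrow> poly C c = 0" and c: "c \<in> S"
  shows "pdiff H (v1 + c *s v0) v0 \<noteq> 0"
proof -
  have "((\<lambda>s. poly C s) has_field_derivative pdiff H (v1 + c *s v0) v0) (at c)"
    unfolding C_eq_H by (rule peval_line_derivative)
  then have "poly (pderiv C) c = pdiff H (v1 + c *s v0) v0"
    using DERIV_unique[OF poly_DERIV] by blast
  then show ?thesis
    using simple_roots_of_split_poly[where p = C and S = S and c = c] S c normal_poly(2) d by auto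
qed

lemma in_span_01:
  assumes "q \<in> vec.span {v0, v1}"
  shows "q = dotc a0 q *s v0 + dotc a1 q *s v1"
proof -
  obtain x y where "q = x *s v0 + y *s v1"
    using assms by (auto simp: vec.span_insert vec.span_singleton algebra_simps)
  then show ?thesis by simp
qed

lemma A_singularity_point:
  assumes A: "A_singularity k F Q" and Q: "Q \<subseteq> vec.span {v0, v1}"
  obtains c where "Q = vec.span {v1 + c *s v0}" "poly C c = 0"
proof -
  \<comment> \<open>A point of the line with vanishing \<open>x_1\<close> is the one spanned by
    \<open>v0\<close>, where the differential is nonzero.\<close>
  have a1: "dotc a1 q \<noteq> 0" if q: "q \<in> Q" "q \<noteq> 0" for q
  proof
    assume "dotc a1 q = 0"
    then have q_eq: "q = dotc a0 q *s v0" using in_span_01[of q] Q q by auto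
    then have "dotc a0 q \<noteq> 0" using q by auto
    moreover have "pdiff F q v2 = 0" using A_singularity_critical[OF A F q] .
    ultimately show False
      using pdiff_scale_left[OF F, of "dotc a0 q" v0 v2] smooth by (metis mult_eq_0_iff power_not_zero q_eq)
  qed
  obtain p where p: "p \<noteq> 0" "Q = vec.span {p}"
    using A unfolding A_singularity_def by blast
  have pQ: "p \<in> Q" by (simp add: p vec.span_base)
  define c where "c = dotc a0 p / dotc a1 p"
  have ap: "dotc a1 p \<noteq> 0" using a1[OF pQ p(1)] .
  have p_eq: "p = dotc a1 p *s (v1 + c *s v0)"
  proof -
    have "dotc a1 p *s (v1 + c *s v0) = dotc a0 p *s v0 + dotc a1 p *s v1"
      using ap by (simp add: c_def vec_eq_iff field_simps)
    also have "\<dots> = p" by (rule in_span_01[symmetric]) (use pQ Q in blast)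
    finally show ?thesis by (rule sym)
  qed
  have "inverse (dotc a1 p) *s (dotc a1 p *s (v1 + c *s v0)) = v1 + c *s v0"
    using ap by simp
  then have "v1 + c *s v0 = inverse (dotc a1 p) *s p"
    by (metis p_eq)
  then have v: "v1 + c *s v0 \<in> Q" using p by (metis insertI1 vec.span_base vec.span_scale)
  moreover have "v1 + c *s v0 \<noteq> 0" using p_eq p(1) vector_smult_rzero by metis
  ultimately have "poly C c = 0" using A_singularity_critical[OF A F] normal_poly by simp
  moreover have "p \<in> vec.span {v1 + c *s v0}"
    by (subst p_eq) (intro vec.span_scale vec.span_base singletonI)
  then have "Q = vec.span {v1 + c *s v0}"
    unfolding p(2) vec.span_eq using v p by auto
  ultimately show ?thesis using that by blast
qed

text \<open>
  Along the arc of a singular point the equations for the three partial derivatives force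
  \<open>x\<^sub>2 = O(s\<^bsup>d-1\<^esup>)\<close>, \<open>H = O(s\<^bsup>d-1\<^esup>)\<close> and \<open>r'(x\<^sub>3) = O(s\<^bsup>d-1\<^esup>)\<close>. The first two leave only the
  \<open>x\<^sub>3\<close>-direction for the tangent of the arc, so \<open>x\<^sub>3\<close> has order exactly one in \<open>s\<close>.
\<close>

lemma restriction_order:
  assumes A: "A_singularity (d - 1) F (vec.span {v1 + c *s v0})"
    and c: "pdiff H (v1 + c *s v0) v0 \<noteq> 0" "poly C c = 0"
  shows "\<And>k. k < d - 1 \<Longrightarrow> coeff (pderiv r) k = 0"
proof -
  have a1: "dotc a1 q \<noteq> 0" if q: "q \<in> vec.span {v1 + c *s v0}" "q \<noteq> 0" for q
    using q by (auto simp: vec.span_singleton)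
  obtain p \<gamma> \<gamma>' where arc: "dotc a1 p = 1" "vec.span {v1 + c *s v0} = vec.span {p}" "\<gamma> 0 = p"
    "\<And>i. ((\<lambda>s. \<gamma> s $ i) has_field_derivative \<gamma>' $ i) (at 0)" "\<gamma>' \<noteq> 0"
    "eventually (\<lambda>s. dotc a1 (\<gamma> s) = 1) (nhds 0)"
    "\<And>h. (\<lambda>s. pdiff F (\<gamma> s) h) \<in> O[at 0](\<lambda>s. s ^ (d - 1))"
    using A_singularity_affine_arc[OF A F a1] by blast
  have "p \<in> vec.span {v1 + c *s v0}" unfolding arc(2) by (simp add: vec.span_base)
  then obtain k where "p = k *s (v1 + c *s v0)" by (auto simp: vec.span_singleton)
  with arc(1) have p: "p = v1 + c *s v0" by simp
  have ev: "eventually (\<lambda>s. dotc a1 (\<gamma> s) = 1) (at 0)"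
    using arc(6) by (simp add: eventually_nhds_conv_at)
  define y2 where "y2 s = dotc a2 (\<gamma> s)" for s
  define y3 where "y3 s = dotc a3 (\<gamma> s)" for s
  have dy2: "(y2 has_field_derivative dotc a2 \<gamma>') (at 0)"
    unfolding y2_def[abs_def] by (rule has_field_derivative_dotc[OF arc(4)])
  have dy3: "(y3 has_field_derivative dotc a3 \<gamma>') (at 0)"
    unfolding y3_def[abs_def] by (rule has_field_derivative_dotc[OF arc(4)])
  have y30: "y3 0 = 0" by (simp add: y3_def arc(3) p)
  have bounded: "h \<in> O[at 0](\<lambda>s. 1)" if "isCont h 0" for h :: "complex \<Rightarrow> complex"
    using that by (intro bigoI_tendsto[of _ _ "h 0"]) (auto simp: isCont_def)
  have contH: "isCont (\<lambda>s. pdiff H (\<gamma> s) h) 0" for h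
    by (rule isCont_pdiff[OF arc(4)])
  have H0: "pdiff H (\<gamma> 0) v0 \<noteq> 0" using c by (simp add: arc p)
  \<comment> \<open>The cofactor of \<open>x_2\<close> in the \<open>v0\<close>-derivative is
    invertible near the point because the root of \<open>C\<close> is simple.\<close>
  have O2: "y2 \<in> O[at 0](\<lambda>s. s ^ (d - 1))"
  proof -
    have "isCont (\<lambda>s. inverse (pdiff H (\<gamma> s) v0)) 0"
      using contH H0 by (intro continuous_intros) auto
    then have "(\<lambda>s. inverse (pdiff H (\<gamma> s) v0) * pdiff F (\<gamma> s) v0) \<in> O[at 0](\<lambda>s. 1 * s ^ (d - 1))"
      by (intro landau_o.big.mult bounded arc)
    moreover have "eventually (\<lambda>s. pdiff H (\<gamma> s) v0 \<noteq> 0) (at 0)"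
      using contH[of v0] H0 by (intro tendsto_imp_eventually_ne) (auto simp: isCont_def)
    with ev have "eventually (\<lambda>s. y2 s = inverse (pdiff H (\<gamma> s) v0) * pdiff F (\<gamma> s) v0) (at 0)"
      by eventually_elim (simp add: pdiff_v0 y2_def)
    ultimately show ?thesis by (simp add: landau_o.big.in_cong)
  qed
  have Oprod: "(\<lambda>s. y2 s * pdiff H (\<gamma> s) h) \<in> O[at 0](\<lambda>s. s ^ (d - 1))" for h
    using landau_o.big.mult[OF O2 bounded[OF contH[of h]]] by simp
  have OH: "(\<lambda>s. peval H (\<gamma> s)) \<in> O[at 0](\<lambda>s. s ^ (d - 1))"
  proof -
    have "(\<lambda>s. pdiff F (\<gamma> s) v2 - y2 s * pdiff H (\<gamma> s) v2) \<in> O[at 0](\<lambda>s. s ^ (d - 1))"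
      by (intro sum_in_bigo arc Oprod)
    moreover have "eventually (\<lambda>s. peval H (\<gamma> s) = pdiff F (\<gamma> s) v2 - y2 s * pdiff H (\<gamma> s) v2) (at 0)"
      using ev by eventually_elim (simp add: pdiff_v2 y2_def)
    ultimately show ?thesis by (simp add: landau_o.big.in_cong)
  qed
  have Or: "(\<lambda>s. poly (pderiv r) (y3 s)) \<in> O[at 0](\<lambda>s. s ^ (d - 1))"
  proof -
    have "(\<lambda>s. pdiff F (\<gamma> s) v3 - y2 s * pdiff H (\<gamma> s) v3) \<in> O[at 0](\<lambda>s. s ^ (d - 1))"
      by (intro sum_in_bigo arc Oprod)
    moreover have "eventually (\<lambda>s. poly (pderiv r) (y3 s) = pdiff F (\<gamma> s) v3 - y2 s * pdiff H (\<gamma> s) v3) (at 0)"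
      using ev by eventually_elim (simp add: pdiff_v3 y2_def y3_def)
    ultimately show ?thesis by (simp add: landau_o.big.in_cong)
  qed
  \<comment> \<open>Order at least two is what forces the first derivatives of \<open>x_2\<close>
    and \<open>H\<close> along the arc to vanish.\<close>
  have d2: "d - 1 \<ge> 2" using d by simp
  have g2: "dotc a2 \<gamma>' = 0" using bigo_power_derivative_0[OF O2 d2 dy2] .
  have g1: "dotc a1 \<gamma>' = 0"
  proof -
    have "((\<lambda>s. dotc a1 (\<gamma> s)) has_field_derivative dotc a1 \<gamma>') (at 0)"
      by (rule has_field_derivative_dotc[OF arc(4)])
    then have "((\<lambda>s. 1) has_field_derivative dotc a1 \<gamma>') (at 0)"
      using DERIV_cong_ev[OF refl arc(6) refl] by blast
    then show ?thesis using DERIV_unique[OF DERIV_const] by metis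
  qed
  have gH: "pdiff H p \<gamma>' = 0"
    using bigo_power_derivative_0[OF OH d2 has_field_derivative_peval_arc[OF arc(4)]] by (simp add: arc)
  \<comment> \<open>With all other coordinates zero the tangent would be a multiple of
    \<open>v0\<close>, along which \<open>H\<close> has nonzero derivative, contradicting
    \<open>gH\<close>.\<close>
  have g3: "dotc a3 \<gamma>' \<noteq> 0"
  proof
    assume g3: "dotc a3 \<gamma>' = 0"
    have g: "\<gamma>' = dotc a0 \<gamma>' *s v0"
      using expand[of \<gamma>'] g1 g2 g3 by simp
    then have "dotc a0 \<gamma>' * pdiff H p v0 = 0"
      using gH by (metis pdiff_scale_right)
    then have "dotc a0 \<gamma>' = 0" using c by (simp add: p)
    then show False using g arc(5) by simp
  qed
  show "coeff (pderiv r) k = 0" if "k < d - 1" for k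
  proof (rule ccontr)
    assume k: "coeff (pderiv r) k \<noteq> 0"
    \<comment> \<open>Since \<open>y3 s / s\<close> has a nonzero limit, the composite of
      \<open>pderiv r\<close> with \<open>y3\<close> has order exactly \<open>n\<close>, the order
      of \<open>pderiv r\<close> at \<open>0\<close>; the arc bound excludes
      \<open>n < d - 1\<close>.\<close>
    define n where "n = (LEAST n. coeff (pderiv r) n \<noteq> 0)"
    have n: "coeff (pderiv r) n \<noteq> 0" "n \<le> k" and small: "\<And>m. m < n \<Longrightarrow> coeff (pderiv r) m = 0"
      unfolding n_def using LeastI[of "\<lambda>n. coeff (pderiv r) n \<noteq> 0", OF k]
        Least_le[of "\<lambda>n. coeff (pderiv r) n \<noteq> 0", OF k] not_less_Least by auto
    obtain t where t: "pderiv r = monom 1 n * t"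
      using small monom_1_dvd_iff'[of n "pderiv r"] by (auto elim: dvdE)
    have t0: "poly t 0 \<noteq> 0"
      using n(1) by (simp add: t coeff_monom_mult poly_0_coeff_0)
    have "((\<lambda>s. y3 s / s) \<longlongrightarrow> dotc a3 \<gamma>') (at 0)"
      using dy3 y30 by (simp add: has_field_derivative_iff)
    moreover have "((\<lambda>s. poly t (y3 s)) \<longlongrightarrow> poly t 0) (at 0)"
      using isCont_o2[OF DERIV_isCont[OF dy3] poly_isCont, of t] y30 by (simp add: isCont_def)
    ultimately have "((\<lambda>s. (y3 s / s) ^ n * poly t (y3 s)) \<longlongrightarrow> dotc a3 \<gamma>' ^ n * poly t 0) (at 0)"
      by (intro tendsto_mult tendsto_power)
    moreover have "(\<lambda>s. (y3 s / s) ^ n * poly t (y3 s)) = (\<lambda>s. poly (pderiv r) (y3 s) / s ^ n)"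
      by (simp add: t poly_monom power_divide fun_eq_iff)
    moreover have "((\<lambda>s. poly (pderiv r) (y3 s) / s ^ n) \<longlongrightarrow> 0) (at 0)"
      using bigo_power_null[OF Or, of n] n(2) that by simp
    ultimately have "dotc a3 \<gamma>' ^ n * poly t 0 = 0"
      using LIM_unique by metis
    then show False using g3 t0 by simp
  qed
qed

text \<open>The constant coefficient of \<open>r\<close> vanishes because the line lies on the
  surface, the middle ones by assumption, and the degree is at most \<open>d\<close>. The remaining
  coefficient is nonzero because the plane is not contained in the surface.\<close>

lemma restriction_formula:
  assumes "\<And>k. k < d - 1 \<Longrightarrow> coeff (pderiv r) k = 0"
  shows "peval F (y *s v1 + z *s v3) = peval F v3 * z ^ d" and "peval F v3 \<noteq> 0"
proof -
  have "coeff r k = coeff (monom (peval F v3) d) k" for k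
  proof -
    consider "k = 0" | "0 < k" "k < d" | "k = d" | "k > d" by linarith
    then show ?thesis
    proof cases
      case 1
      have "poly r 0 = 0" using section_poly(1)[of 0] line[of 0 1] by simp
      then show ?thesis using 1 d by (simp add: poly_0_coeff_0)
    next
      case 2
      then have "coeff (pderiv r) (k - 1) = 0" using assms[of "k - 1"] by simp
      then show ?thesis using 2 by (simp add: coeff_pderiv)
    next
      case 3
      then show ?thesis using section_poly(3) by simp
    next
      case 4
      then show ?thesis using section_poly(2) by (simp add: coeff_eq_0)
    qed
  qed
  then have "r = monom (peval F v3) d" by (intro poly_eqI)
  then have 1: "peval F (v1 + s *s v3) = peval F v3 * s ^ d" for s
    using section_poly(1)[of s] by (simp add: poly_monom)
  show eq: "peval F (y *s v1 + z *s v3) = peval F v3 * z ^ d" for y z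
  proof (cases "y = 0")
    case True
    then show ?thesis using hom[of z v3] by simp
  next
    case False
    have "y *s v1 + z *s v3 = y *s (v1 + (z / y) *s v3)"
      using False by (simp add: vec_eq_iff field_simps)
    then have "peval F (y *s v1 + z *s v3) = y ^ d * (peval F v3 * (z / y) ^ d)"
      by (metis hom 1)
    then show ?thesis using False by (simp add: power_divide)
  qed
  show "peval F v3 \<noteq> 0"
    using nonzero unfolding inv eq by auto
qed

section \<open>The deformation\<close>

text \<open>The added monomial does not involve \<open>x_0\<close>, which keeps the plane section a
  cone, nor \<open>x_2\<close>, which leaves \<open>H\<close> and with it the position of the
  singular points unchanged. At those points \<open>x_1 = 1\<close>, so it lowers the order of the
  section in \<open>x_3\<close> from \<open>d\<close> to \<open>d - 1\<close>.\<close>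

definition deformation :: "complex \<Rightarrow> 4 cpoly" where
  "deformation t = F + pconst t * (plinear a3 ^ (d - 1) * plinear a1)"

lemma peval_deformation: "peval (deformation t) x = peval F x + t * (dotc a3 x ^ (d - 1) * dotc a1 x)"
  by (simp add: deformation_def)

lemma deformation_0: "deformation 0 = F"
  by (rule cpoly_eqI) (simp add: peval_deformation)

lemma form_deformation:
  assumes "peval F v3 \<noteq> 0"
  shows "form d (deformation t)"
  unfolding form_iff
proof (intro conjI allI)
  show "deformation t \<noteq> 0"
    using assms peval_deformation[of t v3] by auto
  fix a :: complex and x
  have "a ^ d = a ^ (d - 1) * a" using d power_minus_mult[of d a] by simp
  then show "peval (deformation t) (a *s x) = a ^ d * peval (deformation t) x"
    using hom[of a x] by (simp add: peval_deformation power_mult_distrib algebra_simps)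
qed

lemma smooth_deformation: "pdiff (deformation t) v0 v2 \<noteq> 0"
proof -
  have "peval (deformation t) (v0 + s *s v2) = peval F (v0 + s *s v2)" for s
    using d by (simp add: peval_deformation)
  then have "pdiff (deformation t) v0 v2 = pdiff F v0 v2"
    by (intro pdiff_eqI) (simp add: peval_line_derivative_0)
  then show ?thesis using smooth by simp
qed

lemma irreducible_deformation:
  assumes "peval F v3 \<noteq> 0"
  shows "irreducible (deformation t)"
proof (rule form_irreducible[OF form_deformation[OF assms] _ smooth_deformation])
  show "d \<ge> 1" using d by simp
  \<comment> \<open>The added monomial contains \<open>x_1\<close> and so vanishes on the span of
    \<open>v0\<close> and \<open>v3\<close>; there the deformed form equals
    \<open>F\<close>.\<close>
  show "peval (deformation t) v3 \<noteq> 0" using assms by (simp add: peval_deformation)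
  show "peval (deformation t) (a *s v3 + s *s v0) = peval (deformation t) (a *s v3)" for a s
    using inv[of 0 a s] by (simp add: peval_deformation)
qed

lemma smooth_star_point_deformation:
  assumes c: "peval F v3 \<noteq> 0" and R: "\<And>y z. peval F (y *s v1 + z *s v3) = peval F v3 * z ^ d"
  shows "smooth_star_point d (deformation t) (vec.span {v0})"
proof -
  have dim0: "vec.dim {v0} = 1"
    using v0_nonzero dim_insert_new[of v0 "{}"] by simp
  have n1: "v1 \<notin> vec.span {v0}"
  proof
    assume "v1 \<in> vec.span {v0}"
    then obtain k where "v1 = k *s v0" by (auto simp: vec.span_singleton)
    then have "dotc a1 v1 = dotc a1 (k *s v0)" by simp
    then show False by simp
  qed
  have n3: "v3 \<notin> vec.span {v1, v0}"
  proof
    assume "v3 \<in> vec.span {v1, v0}"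
    then have "v3 \<in> vec.span {v0, v1}" by (simp add: insert_commute)
    then have "dotc a3 v3 = dotc a3 (dotc a0 v3 *s v0 + dotc a1 v3 *s v1)"
      using in_span_01[of v3] by simp
    then show False by simp
  qed
  have dim3: "vec.dim {v3, v1, v0} = 3"
    using dim_insert_new[OF n3] dim_insert_new[OF n1] dim0 by simp
  have point: "proj_point (vec.span {v0})"
    using dim0 by (simp add: proj_point_def vec.subspace_span)
  have plane: "proj_plane (vec.span {v3, v1, v0})"
    using dim3 by (simp add: proj_plane_def vec.subspace_span)
  have lies: "lies_on (vec.span {v0}) (deformation t)"
    using line[of _ 0] by (auto simp: lies_on_def vec.span_singleton peval_deformation)
  \<comment> \<open>The vertex comes last because the index \<open>0\<close> demanded by
    \<open>cone_section\<close> coincides with \<open>3\<close> in the type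
    \<open>3\<close>.\<close>
  define b :: "complex ^ 4 ^ 3" where "b = vector [v1, v3, v0]"
  have b: "b $ 1 = v1" "b $ 2 = v3" "b $ 3 = v0"
    by (simp_all add: b_def)
  have "(0::3) = 3" by simp
  then have b0: "b $ 0 = v0" using b(3) by metis
  define G :: "3 cpoly" where
    "G = pconst (peval F v3) * pvar 2 ^ d + pconst t * (pvar 2 ^ (d - 1) * pvar 1)"
  have "cone_section d (deformation t) (vec.span {v3, v1, v0}) (vec.span {v0})"
    unfolding cone_section_def
  proof (intro exI[of _ b] exI[of _ G] conjI allI)
    show "vec.span (range (($) b)) = vec.span {v3, v1, v0}"
      unfolding range_vec_3 b by (simp add: insert_commute)
    show "vec.span {b $ 0} = vec.span {v0}" by (simp only: b0)
    show eq: "peval (deformation t) (lin_comb b y) = peval G y" for y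
    proof -
      have "peval F (lin_comb b y) = peval F v3 * (y $ 2) ^ d"
        using inv[of "y $ 1" "y $ 2" "y $ 3"] R by (simp add: lin_comb_3 b)
      then show ?thesis by (simp add: peval_deformation G_def lin_comb_3 b)
    qed
    show "not_involving 0 G"
      unfolding G_def
      by (intro not_involving_add not_involving_mult not_involving_pconst not_involving_power
          not_involving_pvar) simp_all
    show "form d G"
      unfolding form_iff
    proof (intro conjI allI)
      have "peval G (axis 2 1) \<noteq> 0"
        using c d by (simp add: G_def axis_def)
      then show "G \<noteq> 0" by auto
      fix a y
      show "peval G (a *s y) = a ^ d * peval G y"
        using form_deformation[OF c, of t] unfolding form_iff eq[symmetric] lin_comb_scale by blast
    qed
  qed
  then have "star_point d (deformation t) (vec.span {v0})"
    using d form_deformation[OF c] irreducible_deformation[OF c] point plane lies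
    unfolding star_point_def by blast
  moreover have "vec.span {v0} \<notin> Sing (deformation t)"
  proof
    assume "vec.span {v0} \<in> Sing (deformation t)"
    then have "partial i (deformation t) v0 = 0" for i
      using v0_nonzero by (simp add: Sing_def vec.span_base)
    then have "pdiff (deformation t) v0 v2 = 0" by (simp add: pdiff_def)
    then show False using smooth_deformation by blast
  qed
  ultimately show ?thesis by (simp add: smooth_star_point_def)
qed

text \<open>
  In the affine coordinates \<open>w\<close> at a singular point, the deformed equation is
  \<open>w\<^sub>2 H + w\<^sub>3\<^bsup>d-1\<^esup> (c w\<^sub>3 + t)\<close>. Dividing by the unit \<open>c w\<^sub>3 + t\<close> avoids taking a root of it.
\<close>

lemma A_singularity_deformation:
  assumes R: "\<And>y z. peval F (y *s v1 + z *s v3) = peval F v3 * z ^ d"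
    and H0: "peval H (v1 + q *s v0) = 0" and H1: "pdiff H (v1 + q *s v0) v0 \<noteq> 0" and t: "t \<noteq> 0"
  shows "A_singularity (d - 2) (deformation t) (vec.span {v1 + q *s v0})"
proof -
  define p where "p = v1 + q *s v0"
  \<comment> \<open>Omitting \<open>v1\<close> fixes \<open>x_1 = 1\<close> on the chart;
    \<open>w $ 2\<close> and \<open>w $ 3\<close> are then \<open>x_2\<close> and
    \<open>x_3\<close>, while \<open>w $ 1\<close> moves along the line.\<close>
  define b :: "complex ^ 4 ^ 3" where "b = vector [v0, v2, v3]"
  have b: "b $ 1 = v0" "b $ 2 = v2" "b $ 3 = v3" by (simp_all add: b_def)
  define x where "x w = p + lin_comb b w" for w
  define e where "e w = peval F v3 * w $ 3 + t" for w :: "complex ^ 3"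
  define \<eta> where "\<eta> w = peval H (x w) / e w" for w
  \<comment> \<open>The first two entries turn the product \<open>w $ 2 * \<eta> w\<close> into a
    sum of two squares; dividing by \<open>\<i>\<close> supplies the sign.\<close>
  define \<Phi> :: "complex ^ 3 \<Rightarrow> complex ^ 3" where
    "\<Phi> w = vector [(w $ 2 + \<eta> w) / 2, (w $ 2 - \<eta> w) / (2 * \<i>), w $ 3]" for w
  have \<Phi>_nth: "\<Phi> w $ 1 = (w $ 2 + \<eta> w) / 2" "\<Phi> w $ 2 = (w $ 2 - \<eta> w) / (2 * \<i>)" "\<Phi> w $ 3 = w $ 3" for w
    by (simp_all add: \<Phi>_def)
  have dotc_x: "dotc a1 (x w) = 1" "dotc a2 (x w) = w $ 2" "dotc a3 (x w) = w $ 3" for w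
    by (simp_all add: x_def p_def lin_comb_3 b)
  have equation: "peval (deformation t) (x w) = e w * ((\<Phi> w $ 1)\<^sup>2 + (\<Phi> w $ 2)\<^sup>2 + (\<Phi> w $ 3) ^ (d - 2 + 1))"
    if "e w \<noteq> 0" for w
  proof -
    have "peval F (x w) = w $ 2 * peval H (x w) + peval F v3 * (w $ 3) ^ d"
      using F_affine[of "x w"] R[of 1 "w $ 3"] by (simp add: dotc_x)
    moreover have "(w $ 3) ^ d = w $ 3 * (w $ 3) ^ (d - 1)"
      using d power_minus_mult[of d "w $ 3"] by (simp add: mult.commute)
    ultimately have "peval (deformation t) (x w) = w $ 2 * peval H (x w) + e w * (w $ 3) ^ (d - 1)"
      by (simp add: peval_deformation dotc_x e_def algebra_simps)
    moreover have "(\<Phi> w $ 1)\<^sup>2 + (\<Phi> w $ 2)\<^sup>2 = w $ 2 * \<eta> w"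
    proof -
      have "(w $ 2 + \<eta> w)\<^sup>2 - (w $ 2 - \<eta> w)\<^sup>2 = 4 * (w $ 2 * \<eta> w)"
        by (simp add: power2_eq_square algebra_simps)
      then show ?thesis
        by (simp add: \<Phi>_nth power_divide power_mult_distrib flip: diff_divide_distrib)
    qed
    moreover have "d - 2 + 1 = d - 1" using d by simp
    ultimately show ?thesis using that by (simp add: \<Phi>_nth \<eta>_def algebra_simps)
  qed
  define W where "W = {w. e w \<noteq> 0}"
  have cont_e: "continuous_on UNIV e"
    unfolding e_def by (intro continuous_intros)
  have opW: "open W"
    unfolding W_def using open_Collect_neq[OF cont_e continuous_on_const[of _ 0]] .
  have x0: "x 0 = p" by (simp add: x_def lin_comb_def)
  have e0: "e 0 = t" by (simp add: e_def)
  have W0: "0 \<in> W" using t by (simp add: W_def e0)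
  have \<eta>0: "\<eta> 0 = 0" using H0 by (simp add: \<eta>_def x0 p_def)
  have \<Phi>0: "\<Phi> 0 = 0"
    by (simp add: vec_eq_iff forall_3 \<Phi>_nth \<eta>0)
  define Je where "Je j = (if j = 3 then peval F v3 else 0)" for j :: 3
  define J\<eta> where "J\<eta> j w = (pdiff H (x w) (b $ j) * e w - peval H (x w) * Je j) / (e w)\<^sup>2" for j w
  define J where "J i j w = (if i = 1 then ((if j = 2 then 1 else 0) + J\<eta> j w) / 2
      else if i = 2 then ((if j = 2 then 1 else 0) - J\<eta> j w) / (2 * \<i>)
      else if j = 3 then 1 else 0)" for i j :: 3 and w
  have cont_x: "continuous_on S x" for S
    unfolding x_def lin_comb_def vector_scalar_mult_def
    by (intro continuous_intros continuous_on_vec_lambda)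
  have cont_pdiff: "continuous_on S (\<lambda>w. pdiff H (x w) h)" for S h
  proof -
    obtain D where "\<And>y. peval D y = pdiff H y h" using pdiff_as_poly[of H h] by blast
    then show ?thesis using continuous_on_peval[OF cont_x, of S D] by simp
  qed
  have cont_J\<eta>: "continuous_on W (J\<eta> j)" for j
    unfolding J\<eta>_def
    by (intro continuous_intros cont_pdiff cont_x continuous_on_subset[OF cont_e]) (auto simp: W_def)
  have cont_J: "continuous_on W (J i j)" for i j
    unfolding J_def by (cases "i = 1"; cases "i = 2") (auto intro!: continuous_intros cont_J\<eta>)
  have der_x: "(x has_derivative lin_comb b) (at w)" for w
  proof -
    have "linear (lin_comb b)"
      by (intro linearI) (simp_all add: lin_comb_def vec_eq_iff algebra_simps sum.distrib scaleR_sum_right)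
    then have "bounded_linear (lin_comb b)" by (simp add: linear_conv_bounded_linear)
    from has_derivative_add[OF has_derivative_const bounded_linear_imp_has_derivative[OF this]]
    show ?thesis unfolding x_def[abs_def] by simp
  qed
  have der_nth: "((\<lambda>w::complex ^ 3. w $ i) has_derivative (\<lambda>h. h $ i)) (at w)" for i w
    by (rule bounded_linear_imp_has_derivative[OF bounded_linear_vec_nth])
  have der_e: "(e has_derivative (\<lambda>h. peval F v3 * h $ 3)) (at w)" for w
    unfolding e_def[abs_def] by (auto intro!: derivative_eq_intros der_nth)
  have der_H: "((\<lambda>w. peval H (x w)) has_derivative (\<lambda>h. pdiff H (x w) (lin_comb b h))) (at w)" for w
    using diff_chain_at[OF der_x has_derivative_peval] by (simp add: o_def)
  have der_\<eta>: "(\<eta> has_derivative (\<lambda>h. \<Sum>j\<in>UNIV. J\<eta> j w * h $ j)) (at w)" if w: "w \<in> W" for w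
  proof -
    have ew: "e w \<noteq> 0" using w by (simp add: W_def)
    have "(\<eta> has_derivative (\<lambda>h. (pdiff H (x w) (lin_comb b h) * e w - peval H (x w) * (peval F v3 * h $ 3)) / (e w * e w))) (at w)"
      unfolding \<eta>_def[abs_def] by (rule has_derivative_divide'[OF der_H der_e ew])
    also have "(\<lambda>h. (pdiff H (x w) (lin_comb b h) * e w - peval H (x w) * (peval F v3 * h $ 3)) / (e w * e w)) =
        (\<lambda>h. \<Sum>j\<in>UNIV. J\<eta> j w * h $ j)"
      using ew by (simp add: fun_eq_iff sum_3 J\<eta>_def Je_def lin_comb_3 pdiff_add_right pdiff_scale_right
          field_simps power2_eq_square)
    finally show ?thesis .
  qed
  have der: "((\<lambda>w. \<Phi> w $ i) has_derivative (\<lambda>h. \<Sum>j\<in>UNIV. J i j w * h $ j)) (at w)" if w: "w \<in> W" for i w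
  proof -
    consider "i = 1" | "i = 2" | "i = 3" using exhaust_3[of i] by blast
    then show ?thesis
    proof cases
      case 1
      have "((\<lambda>w. (w $ 2 + \<eta> w) / 2) has_derivative (\<lambda>h. (h $ 2 + (\<Sum>j\<in>UNIV. J\<eta> j w * h $ j)) / 2)) (at w)"
        by (auto intro!: derivative_eq_intros der_nth der_\<eta>[OF w])
      then show ?thesis
        by (simp add: 1 \<Phi>_nth J_def sum_3 algebra_simps add_divide_distrib)
    next
      case 2
      have "((\<lambda>w. (w $ 2 - \<eta> w) / (2 * \<i>)) has_derivative (\<lambda>h. (h $ 2 - (\<Sum>j\<in>UNIV. J\<eta> j w * h $ j)) / (2 * \<i>))) (at w)"
        by (auto intro!: derivative_eq_intros der_nth der_\<eta>[OF w])
      then show ?thesis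
        by (simp add: 2 \<Phi>_nth J_def sum_3 algebra_simps add_divide_distrib diff_divide_distrib)
    next
      case 3
      then show ?thesis using der_nth[of 3 w] by (simp add: \<Phi>_nth J_def sum_3)
    qed
  qed
  \<comment> \<open>The last entry gives \<open>h $ 3 = 0\<close>, sum and difference of the first
    two give \<open>h $ 2 = 0\<close> and then \<open>J\<eta> 1 0 * h $ 1 = 0\<close>, whose
    coefficient is nonzero by simplicity of the root.\<close>
  have inj: "h = 0" if h: "\<And>i. (\<Sum>j\<in>UNIV. J i j 0 * h $ j) = 0" for h
  proof -
    let ?s = "\<Sum>j\<in>UNIV. J\<eta> j 0 * h $ j"
    have h3: "h $ 3 = 0" using h[of 3] by (simp add: J_def sum_3)
    have "(h $ 2 + ?s) / 2 = 0" using h[of 1] by (simp add: J_def sum_3 algebra_simps add_divide_distrib)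
    moreover have "(h $ 2 - ?s) / (2 * \<i>) = 0"
      using h[of 2] by (simp add: J_def sum_3 algebra_simps add_divide_distrib diff_divide_distrib)
    ultimately have "h $ 2 + ?s = 0" "h $ 2 - ?s = 0" by simp_all
    then have h2: "h $ 2 = 0" and s: "?s = 0"
      by (auto simp: add_eq_0_iff)
    have "J\<eta> 1 0 * h $ 1 = 0" using s h2 h3 by (simp add: sum_3)
    moreover have "J\<eta> 1 0 \<noteq> 0"
      using H1 t by (simp add: J\<eta>_def Je_def x0 e0 b p_def)
    ultimately have "h $ 1 = 0" by simp
    then show ?thesis using h2 h3 by (simp add: vec_eq_iff forall_3)
  qed
  obtain U V f where bi: "biholomorphic U V f" "V \<subseteq> W" "\<Phi> 0 \<in> U" "0 \<in> V" "f (\<Phi> 0) = 0"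
    "\<And>z. z \<in> U \<Longrightarrow> \<Phi> (f z) = z"
    using biholomorphicI_inverse_function[OF opW W0 der cont_J inj] by blast
  have UV: "open U" "\<And>z. z \<in> U \<Longrightarrow> f z \<in> V"
    using bi(1) mholomorphic_on_open unfolding biholomorphic_def by blast+
  have f3: "f z $ 3 = z $ 3" if "z \<in> U" for z
    using \<Phi>_nth(3)[of "f z"] bi(6)[OF that] by simp
  \<comment> \<open>This is \<open>e\<close> in the new coordinates: \<open>f\<close> preserves the
    third coordinate, on which alone \<open>e\<close> depends.\<close>
  define u where "u z = peval F v3 * z $ 3 + t" for z :: "complex ^ 3"
  have "mholomorphic_on u U"
    unfolding mholomorphic_on_def
  proof (intro conjI ballI UV)
    fix z
    have "(u has_derivative (\<lambda>h. peval F v3 * h $ 3)) (at z)"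
      unfolding u_def[abs_def] by (auto intro!: derivative_eq_intros der_nth)
    then have "(u has_derivative (\<lambda>h. \<Sum>j\<in>UNIV. (\<chi> j. Je j) $ j * h $ j)) (at z)"
      by (simp add: sum_3 Je_def)
    then show "\<exists>g. (u has_derivative (\<lambda>h. \<Sum>j\<in>UNIV. g $ j * h $ j)) (at z)" by blast
  qed
  moreover have "u z \<noteq> 0 \<and> peval (deformation t) (p + lin_comb b (f z)) =
      u z * ((z $ 1)\<^sup>2 + (z $ 2)\<^sup>2 + (z $ 3) ^ (d - 2 + 1))" if z: "z \<in> U" for z
  proof -
    have "e (f z) = u z" by (simp add: e_def u_def f3[OF z])
    moreover have "e (f z) \<noteq> 0" using UV(2)[OF z] bi(2) by (auto simp: W_def)
    ultimately show ?thesis using equation[of "f z"] bi(6)[OF z] by (simp add: x_def)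
  qed
  moreover have "p \<noteq> 0"
    using dotc_x(1)[of 0] x0 by auto
  moreover have "vec.span (insert p (range (($) b))) = UNIV"
  proof -
    have "v1 \<in> vec.span {p, v0, v2, v3}"
    proof -
      have "v1 = p - q *s v0" by (simp add: p_def)
      then show ?thesis by (metis insertI1 insertI2 vec.span_base vec.span_diff vec.span_scale)
    qed
    then have "{v0, v1, v2, v3} \<subseteq> vec.span {p, v0, v2, v3}"
      by (auto intro: vec.span_base)
    then have "vec.span {v0, v1, v2, v3} \<subseteq> vec.span {p, v0, v2, v3}"
      by (rule vec.span_minimal) (rule vec.subspace_span)
    then show ?thesis using span by (auto simp: range_vec_3 b)
  qed
  moreover have "d - 2 \<ge> 1" using d by simp
  ultimately show ?thesis
    unfolding A_singularity_def p_def[symmetric] using bi \<Phi>0 by metis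
qed

lemma lookup_deformation:
  "Poly_Mapping.lookup (deformation t) m =
    Poly_Mapping.lookup F m + t * Poly_Mapping.lookup (plinear a3 ^ (d - 1) * plinear a1) m"
  by (simp add: deformation_def lookup_add lookup_pconst_mult)

end

section \<open>Assembly of the family\<close>

lemma holomorphic_subspaces_const:
  assumes "open D" "vec.dim (vec.span (v ` {..<k})) = k"
  shows "holomorphic_subspaces k D (\<lambda>t. vec.span (v ` {..<k}))"
  unfolding holomorphic_subspaces_def
proof (intro ballI)
  fix t0 assume "t0 \<in> D"
  then show "\<exists>N w. open N \<and> t0 \<in> N \<and> N \<subseteq> D \<and> (\<forall>j<k. \<forall>i. (\<lambda>t. w j t $ i) holomorphic_on N) \<and>
      (\<forall>t\<in>N. vec.span (v ` {..<k}) = vec.span ((\<lambda>j. w j t) ` {..<k}) \<and> vec.dim (vec.span (v ` {..<k})) = k)"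
    using assms by (intro exI[of _ D] exI[of _ "\<lambda>j t. v j"]) auto
qed

theorem theorem4p9:
  fixes d :: nat and F :: "4 cpoly" and L P :: proj_subspace
  assumes "d \<ge> 3"
    and "form d F" and "irreducible F"
    and "proj_line L" and "lies_on L F"
    and "\<not> (\<forall>Q. proj_point Q \<and> Q \<subseteq> L \<longrightarrow> Q \<in> Sing F)"
    and "\<exists>S. card S = d - 1 \<and> (\<forall>Q\<in>S. Q \<subseteq> L \<and> A_singularity (d - 1) F Q)"
    and "smooth_star_point d F P" and "P \<subseteq> L"
  shows "\<exists>r Ft Lt Pt.
    one_parameter_family d r Ft Lt Pt \<and> Ft 0 = F \<and> Lt 0 = L \<and> Pt 0 = P \<and>
    (\<forall>t\<in>ball 0 r - {0}.
       (\<exists>S. card S = d - 1 \<and> (\<forall>Q\<in>S. Q \<subseteq> Lt t \<and> A_singularity (d - 2) (Ft t) Q)) \<and>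
       smooth_star_point d (Ft t) (Pt t) \<and> Pt t \<subseteq> Lt t)"
proof -
  obtain v0 v1 v2 v3 where P_eq: "P = vec.span {v0}" and L_eq: "L = vec.span {v0, v1}"
    and span: "vec.span {v0, v1, v2, v3} = UNIV"
    and inv: "\<And>x s. x \<in> vec.span {v0, v1, v3} \<Longrightarrow> peval F (x + s *s v0) = peval F x"
    and smooth: "pdiff F v0 v2 \<noteq> 0" and nonzero: "\<exists>x\<in>vec.span {v0, v1, v3}. peval F x \<noteq> 0"
    using star_point_frame[OF assms(1,2,4,5,8,9)] by blast
  obtain a0 a1 a2 a3 where dual:
    "dotc a0 v0 = 1" "dotc a0 v1 = 0" "dotc a0 v2 = 0" "dotc a0 v3 = 0"
    "dotc a1 v0 = 0" "dotc a1 v1 = 1" "dotc a1 v2 = 0" "dotc a1 v3 = 0"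
    "dotc a2 v0 = 0" "dotc a2 v1 = 0" "dotc a2 v2 = 1" "dotc a2 v3 = 0"
    "dotc a3 v0 = 0" "dotc a3 v1 = 0" "dotc a3 v2 = 0" "dotc a3 v3 = 1"
    and expand: "\<And>x. x = dotc a0 x *s v0 + dotc a1 x *s v1 + dotc a2 x *s v2 + dotc a3 x *s v3"
    using dual_basis_4[OF span] by blast
  interpret star_frame d F v0 v1 v2 v3 a0 a1 a2 a3
  proof
    show "peval F (s *s v0 + y *s v1) = 0" for s y
    proof -
      have "s *s v0 + y *s v1 \<in> L"
        unfolding L_eq by (intro vec.span_add vec.span_scale vec.span_base) simp_all
      then show ?thesis using assms(5) by (simp add: lies_on_def)
    qed
    show "peval F (y *s v1 + z *s v3 + s *s v0) = peval F (y *s v1 + z *s v3)" for s y z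
      by (intro inv vec.span_add vec.span_scale vec.span_base) simp_all
    obtain x where x: "x \<in> vec.span {v0, v1, v3}" "peval F x \<noteq> 0" using nonzero by blast
    obtain s y z where "x = y *s v1 + z *s v3 + s *s v0"
      using x(1) by (auto simp: vec.span_insert vec.span_singleton algebra_simps)
    then show "\<exists>s y z. peval F (y *s v1 + z *s v3 + s *s v0) \<noteq> 0" using x(2) by blast
  qed (fact assms dual expand span smooth)+
  obtain S where S: "card S = d - 1" "\<And>Q. Q \<in> S \<Longrightarrow> Q \<subseteq> L \<and> A_singularity (d - 1) F Q"
    using assms(7) by blast
  have "\<forall>Q\<in>S. \<exists>c. Q = vec.span {v1 + c *s v0} \<and> poly C c = 0"
    using S(2) A_singularity_point[of "d - 1"] unfolding L_eq by metis
  then obtain c where c: "\<And>Q. Q \<in> S \<Longrightarrow> Q = vec.span {v1 + c Q *s v0} \<and> poly C (c Q) = 0"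
    by metis
  \<comment> \<open>The parameter determines the point, so distinct singular points give distinct
    roots of \<open>C\<close>.\<close>
  have "inj_on c S" using c by (metis inj_onI)
  then have card: "card (c ` S) = d - 1" using S by (simp add: card_image)
  have simple: "pdiff H (v1 + c Q *s v0) v0 \<noteq> 0" if "Q \<in> S" for Q
    by (rule simple_root[OF card]) (use c that in auto)
  have "S \<noteq> {}" using S(1) assms(1) by auto
  \<comment> \<open>The section polynomial \<open>r\<close> is the same at every point of the line,
    so its order can be computed at any one singular point.\<close>
  then obtain Q where Q: "Q \<in> S" by blast
  have order: "\<And>k. k < d - 1 \<Longrightarrow> coeff (pderiv r) k = 0"
    using restriction_order[of "c Q"] simple[OF Q] c[OF Q] S(2)[OF Q] by metis
  note R = restriction_formula[OF order]
  have sing: "A_singularity (d - 2) (deformation t) Q" if "Q \<in> S" "t \<noteq> 0" for Q t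
  proof -
    have "peval H (v1 + c Q *s v0) = 0" using c[OF that(1)] C_eq_H by metis
    then show ?thesis
      using A_singularity_deformation[OF R(1) _ simple[OF that(1)] that(2)] c[OF that(1)] by metis
  qed
  have star: "smooth_star_point d (deformation t) P" for t
    unfolding P_eq by (rule smooth_star_point_deformation[OF R(2) R(1)])
  \<comment> \<open>The deformation is defined for every \<open>t\<close>; the radius
    \<open>1\<close> is an arbitrary choice.\<close>
  have family: "one_parameter_family d 1 deformation (\<lambda>_. L) (\<lambda>_. P)"
    unfolding one_parameter_family_def
  proof (intro conjI ballI allI)
    show "form d (deformation t)" for t by (rule form_deformation[OF R(2)])
    show "(\<lambda>t. Poly_Mapping.lookup (deformation t) m) holomorphic_on ball 0 1" for m
      unfolding lookup_deformation by (intro holomorphic_intros)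
    have "L = vec.span ((\<lambda>j::nat. if j = 0 then v0 else v1) ` {..<2})"
      by (simp add: L_eq lessThan_nat_numeral lessThan_Suc insert_commute)
    moreover have "vec.dim L = 2" using assms(4) by (simp add: proj_line_def)
    ultimately show "holomorphic_subspaces 2 (ball 0 1) (\<lambda>_. L)"
      using holomorphic_subspaces_const[of "ball 0 1" "\<lambda>j. if j = 0 then v0 else v1" 2] by simp
    have "P = vec.span ((\<lambda>j::nat. v0) ` {..<1})"
      by (simp add: P_eq lessThan_Suc)
    moreover have "vec.dim P = 1"
      using assms(8) by (simp add: smooth_star_point_def star_point_def proj_point_def)
    ultimately show "holomorphic_subspaces 1 (ball 0 1) (\<lambda>_. P)"
      using holomorphic_subspaces_const[of "ball 0 1" "\<lambda>j. v0" 1] by simp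
  qed simp
  have points: "\<exists>S. card S = d - 1 \<and> (\<forall>Q\<in>S. Q \<subseteq> L \<and> A_singularity (d - 2) (deformation t) Q)"
    if "t \<in> ball 0 1 - {0}" for t
  proof (intro conjI exI[of _ S] ballI)
    show "card S = d - 1" by (rule S(1))
    fix Q assume "Q \<in> S"
    then show "Q \<subseteq> L" "A_singularity (d - 2) (deformation t) Q"
      using S(2) sing that by auto
  qed
  show ?thesis
  proof (rule exI[of _ 1], rule exI[of _ deformation], rule exI[of _ "\<lambda>_. L"],
      rule exI[of _ "\<lambda>_. P"], intro conjI ballI)
  qed (rule family deformation_0 refl star assms(9) points | assumption)+
qed

end
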